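(* Every one-relator group is monotileable.
   Context: A one-relator group is a group admitting a finite presentation with a single relator. A tile of a group $G$ is a subset $T \subset G$ such that $G$ is a disjoint union of (left) translates $gT$, $g \in G$. A group $G$ is monotileable if every finite subset of $G$ is contained in a finite tile of $G$. *)

theory Defs
  imports "HOL-Algebra.Coset" "HOL-Library.Disjoint_Sets"
begin

section \<open>Free groups\<close>

text \<open>The letter \<open>(x, True)\<close> stands for the generator \<open>x\<close>, and
  \<open>(x, False)\<close> for its formal inverse.\<close>

type_synonym 'x letter = "'x \<times> bool"

definition letter_inv :: "'x letter \<Rightarrow> 'x letter" where
  "letter_inv l = (fst l, \<not> snd l)"

definition reduced :: "'x letter list \<Rightarrow> bool" where
  "reduced w \<longleftrightarrow> successively (\<lambda>l m. m \<noteq> letter_inv l) w"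

text \<open>For reduced \<open>w\<close>, \<open>cons_letter l w\<close> is the reduced form of
  \<open>l # w\<close>.\<close>

fun cons_letter :: "'x letter \<Rightarrow> 'x letter list \<Rightarrow> 'x letter list" where
  "cons_letter l [] = [l]"
| "cons_letter l (m # w) = (if m = letter_inv l then w else l # m # w)"

definition free_reduce :: "'x letter list \<Rightarrow> 'x letter list" where
  "free_reduce w = foldr cons_letter w []"

definition free_group :: "'x set \<Rightarrow> 'x letter list monoid" where
  "free_group X =
    \<lparr> carrier = {w. reduced w \<and> fst ` set w \<subseteq> X},
      mult = (\<lambda>v w. free_reduce (v @ w)),
      one = [] \<rparr>"

lemma letter_inv_letter_inv [simp]: "letter_inv (letter_inv l) = l"
  by (simp add: letter_inv_def)

lemma fst_letter_inv [simp]: "fst (letter_inv l) = fst l"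
  by (simp add: letter_inv_def)

lemma reduced_Nil [simp]: "reduced []"
  by (simp add: reduced_def)

lemma reduced_Cons:
  "reduced (l # w) \<longleftrightarrow> w = [] \<or> hd w \<noteq> letter_inv l \<and> reduced w"
  by (auto simp: reduced_def successively_Cons)

lemma reduced_cons_letter: "reduced w \<Longrightarrow> reduced (cons_letter l w)"
  by (cases w) (auto simp: reduced_Cons)

lemma set_cons_letter: "set (cons_letter l w) \<subseteq> insert l (set w)"
  by (cases w) auto

lemma reduced_foldr: "reduced w \<Longrightarrow> reduced (foldr cons_letter v w)"
  by (induction v) (auto simp: reduced_cons_letter)

lemma set_foldr: "set (foldr cons_letter v w) \<subseteq> set v \<union> set w"
proof (induction v)
  case (Cons l v)
  then show ?case using set_cons_letter [of l "foldr cons_letter v w"] by auto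
qed simp

lemma cons_letter_reduced: "reduced (l # w) \<Longrightarrow> cons_letter l w = l # w"
  by (cases w) (auto simp: reduced_Cons)

lemma free_reduce_reduced: "reduced w \<Longrightarrow> free_reduce w = w"
proof (induction w)
  case (Cons l w)
  then have "free_reduce w = w"
    by (auto simp: reduced_Cons free_reduce_def)
  then show ?case
    using Cons.prems by (simp add: free_reduce_def cons_letter_reduced)
qed (simp add: free_reduce_def)

lemma free_reduce_append:
  "reduced w \<Longrightarrow> free_reduce (v @ w) = foldr cons_letter v w"
  using free_reduce_reduced [of w] by (simp add: free_reduce_def)

lemma cons_letter_inv:
  assumes "reduced w"
  shows "cons_letter (letter_inv l) (cons_letter l w) = w"
proof (cases w)
  case (Cons m u)
  then show ?thesis using assms
    by (cases u) (auto simp: reduced_Cons)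
qed simp

lemma foldr_cons_letter:
  assumes "reduced z"
  shows "foldr cons_letter (cons_letter l w) z
       = cons_letter l (foldr cons_letter w z)"
proof (cases w)
  case (Cons m u)
  have "cons_letter l (cons_letter (letter_inv l) (foldr cons_letter u z))
      = foldr cons_letter u z"
    using cons_letter_inv [OF reduced_foldr [OF assms], of "letter_inv l"] by simp
  with Cons show ?thesis by auto
qed simp

lemma foldr_foldr_cons_letter:
  assumes "reduced z"
  shows "foldr cons_letter (foldr cons_letter v w) z
       = foldr cons_letter v (foldr cons_letter w z)"
  using assms by (induction v) (auto simp: foldr_cons_letter)

lemma foldr_letter_inv:
  "foldr cons_letter (rev (map letter_inv v)) v = []"
proof (induction v)
  case (Cons l v)
  then show ?case by simp
qed simp

lemma reduced_inverse:
  "reduced w \<Longrightarrow> reduced (rev (map letter_inv w))"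
  by (auto simp: reduced_def successively_map elim!: successively_mono)

theorem group_free_group: "group (free_group X)"
proof (rule groupI)
  fix u v assume "u \<in> carrier (free_group X)" "v \<in> carrier (free_group X)"
  then show "u \<otimes>\<^bsub>free_group X\<^esub> v \<in> carrier (free_group X)"
    using set_foldr [of u v]
    by (fastforce simp: free_group_def free_reduce_append reduced_foldr)
next
  fix u v w
  assume "u \<in> carrier (free_group X)" "v \<in> carrier (free_group X)"
    "w \<in> carrier (free_group X)"
  then show "u \<otimes>\<^bsub>free_group X\<^esub> v \<otimes>\<^bsub>free_group X\<^esub> w
      = u \<otimes>\<^bsub>free_group X\<^esub> (v \<otimes>\<^bsub>free_group X\<^esub> w)"
    by (simp add: free_group_def free_reduce_append reduced_foldr
        foldr_foldr_cons_letter del: foldr_append)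
next
  fix w assume w: "w \<in> carrier (free_group X)"
  show "\<exists>v\<in>carrier (free_group X). v \<otimes>\<^bsub>free_group X\<^esub> w = \<one>\<^bsub>free_group X\<^esub>"
  proof
    show "rev (map letter_inv w) \<in> carrier (free_group X)"
      using w reduced_inverse [of w] by (auto simp: free_group_def)
    show "rev (map letter_inv w) \<otimes>\<^bsub>free_group X\<^esub> w = \<one>\<^bsub>free_group X\<^esub>"
      using w by (simp add: free_group_def free_reduce_append foldr_letter_inv
          del: foldr_append)
  qed
qed (auto simp: free_group_def free_reduce_reduced)


section \<open>Presentations\<close>

definition normal_closure :: "('a, 'b) monoid_scheme \<Rightarrow> 'a set \<Rightarrow> 'a set" where
  "normal_closure G R = \<Inter> {N. N \<lhd> G \<and> R \<subseteq> N}"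

definition presented_group :: "'x set \<Rightarrow> 'x letter list set \<Rightarrow> 'x letter list set monoid"
  where "presented_group X R = free_group X Mod normal_closure (free_group X) R"

lemma (in group) normal_normal_closure:
  assumes "R \<subseteq> carrier G"
  shows "normal_closure G R \<lhd> G"
proof -
  have "carrier G \<lhd> G"
    using subgroup_self by (simp add: normal_inv_iff)
  then have "subgroup (normal_closure G R) G"
    unfolding normal_closure_def using assms
    by (intro subgroups_Inter) (auto dest: normal_imp_subgroup)
  then show ?thesis
    by (auto simp: normal_inv_iff normal_closure_def)
qed

lemma group_presented_group:
  assumes "R \<subseteq> carrier (free_group X)"
  shows "group (presented_group X R)"
  unfolding presented_group_def
  by (intro normal.factorgroup_is_group group.normal_normal_closure
      group_free_group assms)

text \<open>The generators are named by natural numbers, which is no restriction for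
  a finite generating set. The relator may be the empty word.\<close>

definition one_relator_group :: "('a, 'b) monoid_scheme \<Rightarrow> bool" where
  "one_relator_group G \<longleftrightarrow> group G \<and>
    (\<exists>(X :: nat set) r. finite X \<and> r \<in> carrier (free_group X) \<and>
      G \<cong> presented_group X {r})"


section \<open>Tiles\<close>

text \<open>\<open>C\<close> contains one representative \<open>g\<close> of each translate
  that occurs in the disjoint union.\<close>

definition tile :: "('a, 'b) monoid_scheme \<Rightarrow> 'a set \<Rightarrow> bool" where
  "tile G T \<longleftrightarrow> T \<subseteq> carrier G \<and>
    (\<exists>C \<subseteq> carrier G. disjoint_family_on (\<lambda>g. g <#\<^bsub>G\<^esub> T) C \<and>
      (\<Union>g\<in>C. g <#\<^bsub>G\<^esub> T) = carrier G)"

definition monotileable :: "('a, 'b) monoid_scheme \<Rightarrow> bool" where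
  "monotileable G \<longleftrightarrow>
    (\<forall>F \<subseteq> carrier G. finite F \<longrightarrow> (\<exists>T. finite T \<and> F \<subseteq> T \<and> tile G T))"

end

theory Submission
  imports Defs "HOL-Algebra.Generated_Groups"
begin

text \<open>If every nontrivial finitely generated subgroup of a group has a proper subgroup of finite
  index, then a finite set can be separated into single points by finitely many passages to such
  subgroups, and the tilings glue at each passage because a union of translates of tiles, one
  for each coset, is a tile for the larger group.

  For a one-relator group with cyclically reduced relator \<open>r\<close> of length \<open>N\<close>, every nontrivial finitely
  generated subgroup maps onto a nontrivial subgroup of the integers modulo \<open>2 N\<close>. Otherwise finitely
  many consequences of \<open>r\<close> witness that it does not, and they are visible in a finite subgraph
  \<open>E\<close> of a Schreier graph of the free group: attaching a cell along each closed
  path that reads \<open>r\<close> kills the first cohomology of \<open>E\<close> modulo \<open>2 N\<close>. An edge on no cell is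
  then a bridge, and an edge lying once on one cell can be collapsed. If neither kind exists, there
  are too few cells: by an argument of Louder and Wilton, with the stacking
  of \<open>r\<close> given by a conjugation-invariant order on the free group, the number of
  vertices plus the number of cells is at most the number of edges. So \<open>E\<close> collapses completely,
  and the subgroup is trivial.\<close>

subsection \<open>A conjugation-invariant order on the free group\<close>

text \<open>The modulus \<open>2 * N\<close> has two tasks. Divisibility by \<open>N\<close> detects
  a circle that runs several times round a shorter closed path, which can happen when
  \<open>r\<close> is a proper power; the factor 2 keeps the modulus at least 2 when
  \<open>N = 1\<close>. A finite modulus is also what makes one finite graph sufficient: there are
  only finitely many nonzero residue assignments to the generators, each refuted by one relation,
  and cochains can simply be counted. The obstacle is to pass from vanishing cohomology, which is
  abelian information, to triviality in a nonabelian group. For this the collapse is reversed: a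
  labelling \<open>P\<close> of the vertices by group elements that multiplies by
  \<open>\<theta> x\<close> along every edge labelled \<open>x\<close> is extended over one edge at
  a time. Over a bridge one side is translated; over a collapsed edge the relator forces the
  equation. A closed path at the base vertex then reads a word of value 1.\<close>

text \<open>Functions on the words over \<open>'x\<close> stand for noncommutative power series, and a
  letter acts on them as \<open>1 + x\<close> or its inverse: by \<open>lmul\<close> on the left and by \<open>rmul\<close> on the right.
  So \<open>magnus\<close> is the Magnus embedding.\<close>

primrec lmul_inv :: "'x \<Rightarrow> ('x list \<Rightarrow> int) \<Rightarrow> 'x list \<Rightarrow> int" where
  "lmul_inv x c [] = c []"
| "lmul_inv x c (y # \<nu>) = c (y # \<nu>) - (if y = x then lmul_inv x c \<nu> else 0)"

definition lmul :: "'x letter \<Rightarrow> ('x list \<Rightarrow> int) \<Rightarrow> 'x list \<Rightarrow> int" where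
  "lmul l c = (if snd l
     then (\<lambda>\<mu>. c \<mu> + (case \<mu> of [] \<Rightarrow> 0 | y # \<nu> \<Rightarrow> if y = fst l then c \<nu> else 0))
     else lmul_inv (fst l) c)"

definition rmul :: "'x letter \<Rightarrow> ('x list \<Rightarrow> int) \<Rightarrow> 'x list \<Rightarrow> int" where
  "rmul l c = (\<lambda>\<mu>. lmul l (\<lambda>\<nu>. c (rev \<nu>)) (rev \<mu>))"

definition magnus_one :: "'x list \<Rightarrow> int" where
  "magnus_one \<mu> = (if \<mu> = [] then 1 else 0)"

definition magnus :: "'x letter list \<Rightarrow> 'x list \<Rightarrow> int" where
  "magnus u = foldr lmul u magnus_one"

lemma lmul_lmul_inv_letter [simp]: "lmul l (lmul (letter_inv l) c) = c"
proof
  fix \<mu>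
  have 1: "lmul (x, True) (lmul (x, False) c) \<mu> = c \<mu>" for x
    by (cases \<mu>) (auto simp: lmul_def)
  have 2: "lmul (x, False) (lmul (x, True) c) \<mu> = c \<mu>" for x
    by (induction \<mu>) (auto simp: lmul_def split: list.splits)
  show "lmul l (lmul (letter_inv l) c) \<mu> = c \<mu>"
    using 1 2 by (cases l; cases "snd l") (auto simp: letter_inv_def)
qed

lemma lmul_inv_letter_lmul [simp]: "lmul (letter_inv l) (lmul l c) = c"
  using lmul_lmul_inv_letter [of "letter_inv l" c] by simp

lemma rmul_rmul_inv_letter [simp]: "rmul l (rmul (letter_inv l) c) = c"
  by (simp add: rmul_def)

lemma rmul_inv_letter_rmul [simp]: "rmul (letter_inv l) (rmul l c) = c"
  using rmul_rmul_inv_letter [of "letter_inv l" c] by simp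

lemma rmul_pos:
  "rmul (x, True) c \<mu> = c \<mu> + (if \<mu> \<noteq> [] \<and> last \<mu> = x then c (butlast \<mu>) else 0)"
  by (cases \<mu> rule: rev_cases) (auto simp: rmul_def lmul_def)

lemma lmul_pos:
  "lmul (x, True) c \<mu> = c \<mu> + (if \<mu> \<noteq> [] \<and> hd \<mu> = x then c (tl \<mu>) else 0)"
  by (cases \<mu>) (auto simp: lmul_def)

lemma lmul_rmul_pos:
  "lmul (x, True) (rmul (y, True) c) = rmul (y, True) (lmul (x, True) c)"
proof
  fix \<mu>
  show "lmul (x, True) (rmul (y, True) c) \<mu> = rmul (y, True) (lmul (x, True) c) \<mu>"
  proof (cases \<mu>)
    case (Cons z \<nu>)
    then show ?thesis
      by (cases \<nu> rule: rev_cases) (auto simp: lmul_pos rmul_pos butlast_append)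
  qed (simp add: lmul_pos rmul_pos)
qed

text \<open>Associativity of the multiplication of series. Inverse letters are cancelled against
  their positive counterparts, so only the factors \<open>1 + x\<close> and \<open>1 + y\<close> are
  computed with.\<close>

lemma lmul_rmul: "lmul l (rmul k c) = rmul k (lmul l c)"
proof -
  obtain x a where l: "l = (x, a)" by (cases l)
  obtain y b where k: "k = (y, b)" by (cases k)
  have inv [simp]: "letter_inv (z, False) = (z, True)" for z :: 'a
    by (simp add: letter_inv_def)
  have *: "lmul (x, True) (rmul k c) = rmul k (lmul (x, True) c)" for c
  proof (cases b)
    case False
    have "rmul (y, True) (lmul (x, True) (rmul k c)) = lmul (x, True) c"
      using rmul_rmul_inv_letter [of "(y, True)" c] False k
      by (simp add: lmul_rmul_pos [symmetric] letter_inv_def)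
    then have "rmul k (rmul (y, True) (lmul (x, True) (rmul k c))) = rmul k (lmul (x, True) c)"
      by simp
    then show ?thesis
      using False k rmul_rmul_inv_letter [of k] by simp
  qed (simp add: k lmul_rmul_pos)
  show ?thesis
  proof (cases a)
    case False
    have "lmul (x, True) (rmul k (lmul l c)) = rmul k c"
      using lmul_lmul_inv_letter [of "(x, True)" c] False l
      by (simp add: * letter_inv_def)
    then have "lmul l (lmul (x, True) (rmul k (lmul l c))) = lmul l (rmul k c)"
      by simp
    then show ?thesis
      using False l lmul_lmul_inv_letter [of l] by simp
  qed (simp add: l *)
qed

text \<open>The base case that lets \<open>magnus\<close> also be built from the right; conjugating
  a word by a letter thereby becomes one left and one right multiplication.\<close>

lemma lmul_magnus_one: "lmul l magnus_one = rmul l magnus_one"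
proof -
  have *: "lmul (x, True) magnus_one = rmul (x, True) magnus_one" for x :: 'a

  proof
    fix \<mu> :: "'a list"
    show "lmul (x, True) magnus_one \<mu> = rmul (x, True) magnus_one \<mu>"
    proof (cases \<mu>)
      case (Cons y \<nu>)
      then show ?thesis by (cases \<nu>) (auto simp: lmul_pos rmul_pos magnus_one_def)
    qed (simp add: lmul_pos rmul_pos)
  qed
  obtain x a where l: "l = (x, a)" by (cases l)
  show ?thesis
  proof (cases a)
    case False
    then have inv: "letter_inv l = (x, True)" "letter_inv (x, True) = l"
      by (auto simp: l letter_inv_def)
    have "rmul (x, True) (lmul l magnus_one) = magnus_one"
      using lmul_lmul_inv_letter [of l magnus_one] inv by (simp add: lmul_rmul [symmetric] * [symmetric])
    then have "rmul l (rmul (x, True) (lmul l magnus_one)) = rmul l magnus_one" by simp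
    then show ?thesis using inv rmul_rmul_inv_letter [of l] by simp
  qed (simp add: l *)
qed

lemma magnus_Nil [simp]: "magnus [] = magnus_one"
  and magnus_Cons [simp]: "magnus (l # u) = lmul l (magnus u)"
  by (simp_all add: magnus_def)

lemma magnus_snoc: "magnus (u @ [l]) = rmul l (magnus u)"
  by (induction u) (simp_all add: lmul_magnus_one lmul_rmul)

lemma magnus_append: "magnus (u @ v) = foldr lmul u (magnus v)"
  by (simp add: magnus_def)

lemma magnus_cons_letter: "magnus (cons_letter l u) = magnus (l # u)"
  by (cases u) auto

lemma magnus_free_reduce [simp]: "magnus (free_reduce u) = magnus u"
  by (induction u) (simp_all add: free_reduce_def magnus_cons_letter)

text \<open>Series are compared at the first monomial where they differ, lower degrees first.
  Multiplication by a series with constant term 1 preserves the homogeneous part of lowest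
  degree of a difference, hence the order.\<close>

definition magnus_less :: "('x::linorder list \<Rightarrow> int) \<Rightarrow> ('x list \<Rightarrow> int) \<Rightarrow> bool" where
  "magnus_less c d \<longleftrightarrow> (\<exists>\<mu>. c \<mu> < d \<mu> \<and> (\<forall>\<nu>. (\<nu>, \<mu>) \<in> lenlex {(x, y). x < y} \<longrightarrow> c \<nu> = d \<nu>))"

lemma lmul_diff:
  assumes "\<And>\<nu>. length \<nu> < length \<mu> \<Longrightarrow> c \<nu> = d \<nu>"
  shows "lmul l c \<mu> - lmul l d \<mu> = c \<mu> - d \<mu>"
proof (cases "snd l")
  case True
  then show ?thesis using assms by (cases \<mu>) (auto simp: lmul_def)
next
  case False
  have "lmul_inv x c \<mu> - lmul_inv x d \<mu> = c \<mu> - d \<mu>" for x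
    using assms
  proof (induction \<mu>)
    case (Cons y \<mu>)
    have "lmul_inv x c \<mu> - lmul_inv x d \<mu> = c \<mu> - d \<mu>" "c \<mu> = d \<mu>"
      using Cons.prems by (intro Cons.IH; simp) (simp add: Cons.prems)
    then show ?case by simp
  qed simp
  then show ?thesis using False by (simp add: lmul_def)
qed

lemma rmul_diff:
  assumes "\<And>\<nu>. length \<nu> < length \<mu> \<Longrightarrow> c \<nu> = d \<nu>"
  shows "rmul l c \<mu> - rmul l d \<mu> = c \<mu> - d \<mu>"
  using lmul_diff [of "rev \<mu>" "\<lambda>\<nu>. c (rev \<nu>)" "\<lambda>\<nu>. d (rev \<nu>)" l] assms
  by (simp add: rmul_def)

lemma magnus_less_invariant:
  assumes M: "\<And>\<mu> c d. (\<And>\<nu>. length \<nu> < length \<mu> \<Longrightarrow> c \<nu> = d \<nu>) \<Longrightarrow> M c \<mu> - M d \<mu> = c \<mu> - d \<mu>"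
    and "magnus_less c d"
  shows "magnus_less (M c) (M d)"
proof -
  obtain \<mu> where \<mu>: "c \<mu> < d \<mu>"
    and eq: "\<And>\<nu>. (\<nu>, \<mu>) \<in> lenlex {(x, y). x < y} \<Longrightarrow> c \<nu> = d \<nu>"
    using assms(2) by (auto simp: magnus_less_def)
  have short: "c \<nu> = d \<nu>" if "length \<nu> < length \<mu>" for \<nu>
    using that by (intro eq) (auto simp: lenlex_conv)
  have "M c \<mu> < M d \<mu>" using M [of \<mu> c d] short \<mu> by fastforce
  moreover have "M c \<nu> = M d \<nu>" if "(\<nu>, \<mu>) \<in> lenlex {(x, y). x < y}" for \<nu>
  proof -
    \<comment> \<open>\<open>lenlex\<close> puts shorter lists first, so the series agree on
      everything shorter than \<nu> as well, and \<open>M\<close> leaves their difference at \<nu>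
      unchanged.\<close>
    have "length \<nu> \<le> length \<mu>" using that by (auto simp: lenlex_conv)
    then show ?thesis using M [of \<nu> c d] short eq [OF that] by fastforce
  qed
  ultimately show ?thesis by (auto simp: magnus_less_def)
qed

lemma magnus_less_conjugate:
  assumes "magnus_less (magnus u) (magnus v)"
  shows "magnus_less (magnus (letter_inv l # u @ [l])) (magnus (letter_inv l # v @ [l]))"
  using assms
  by (auto simp: magnus_snoc intro!: magnus_less_invariant [where M = "lmul _"]
      magnus_less_invariant [where M = "rmul _"] lmul_diff rmul_diff)

text \<open>A first monomial of difference exists because \<open>lenlex\<close> is well-founded over
  a well-ordered alphabet; hence the sort \<open>wellorder\<close>.\<close>

lemma magnus_less_total:
  fixes c d :: "'x::wellorder list \<Rightarrow> int"
  assumes "c \<noteq> d"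
  shows "magnus_less c d \<or> magnus_less d c"
proof -
  have wf: "wf (lenlex {(x::'x, y). x < y})" by (rule wf_lenlex [OF wf])
  obtain \<mu>0 where "\<mu>0 \<in> {\<mu>. c \<mu> \<noteq> d \<mu>}" using assms by auto
  with wf obtain \<mu> where \<mu>: "\<mu> \<in> {\<mu>. c \<mu> \<noteq> d \<mu>}"
    "\<And>\<nu>. (\<nu>, \<mu>) \<in> lenlex {(x, y). x < y} \<Longrightarrow> \<nu> \<notin> {\<mu>. c \<mu> \<noteq> d \<mu>}"
    by (rule wfE_min) (rule that)
  have "c \<mu> < d \<mu> \<or> d \<mu> < c \<mu>" using \<mu>(1) by auto
  moreover have "\<And>\<nu>. (\<nu>, \<mu>) \<in> lenlex {(x, y). x < y} \<Longrightarrow> c \<nu> = d \<nu>"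
    using \<mu>(2) by blast
  ultimately show ?thesis unfolding magnus_less_def by (metis (no_types, lifting))
qed

lemma magnus_less_trans:
  assumes "magnus_less c d" "magnus_less d e"
  shows "magnus_less c e"
proof -
  let ?r = "lenlex {(x::'a, y). x < y}"
  have tot: "total ?r" by (rule total_lenlex) (auto simp: total_on_def)
  have tr: "trans ?r" by (rule lenlex_transI) (auto simp: trans_def)
  obtain \<mu> where \<mu>: "c \<mu> < d \<mu>" "\<And>\<nu>. (\<nu>, \<mu>) \<in> ?r \<Longrightarrow> c \<nu> = d \<nu>"
    using assms(1) by (auto simp: magnus_less_def)
  obtain \<mu>' where \<mu>': "d \<mu>' < e \<mu>'" "\<And>\<nu>. (\<nu>, \<mu>') \<in> ?r \<Longrightarrow> d \<nu> = e \<nu>"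
    using assms(2) by (auto simp: magnus_less_def)
  consider "\<mu> = \<mu>'" | "(\<mu>, \<mu>') \<in> ?r" | "(\<mu>', \<mu>) \<in> ?r"
    using tot by (auto simp: total_on_def)
  then show ?thesis
  proof cases
    case 1
    then show ?thesis using \<mu> \<mu>' unfolding magnus_less_def by (intro exI [of _ \<mu>]) auto
  next
    case 2
    then show ?thesis using \<mu> \<mu>' tr unfolding magnus_less_def trans_def
      by (intro exI [of _ \<mu>]) metis
  next
    case 3
    then show ?thesis using \<mu> \<mu>' tr unfolding magnus_less_def trans_def
      by (intro exI [of _ \<mu>']) metis
  qed
qed

lemma magnus_less_irrefl: "\<not> magnus_less c c"
  by (simp add: magnus_less_def)

section \<open>Faithfulness of the Magnus embedding\<close>

lemma lmul_other:
  assumes "\<nu> = [] \<or> hd \<nu> \<noteq> fst l"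
  shows "lmul l c \<nu> = c \<nu>"
  using assms by (cases \<nu>) (auto simp: lmul_def)

text \<open>Beyond its constant term, only the linear term of the series of \<open>l\<close>
  contributes, because the monomial does not begin with a higher power of
  \<open>fst l\<close>.\<close>

lemma lmul_same:
  assumes "\<nu> = [] \<or> hd \<nu> \<noteq> fst l"
  shows "lmul l c (fst l # \<nu>) = c (fst l # \<nu>) + (if snd l then c \<nu> else - c \<nu>)"
  using lmul_other [OF assms, of c] by (auto simp: lmul_def)

lemma length_remdups_adj_map_fst:
  "length (remdups_adj (map fst (l # u))) =
    (if u \<noteq> [] \<and> fst (hd u) = fst l then length (remdups_adj (map fst u))
     else Suc (length (remdups_adj (map fst u))))"
  by (cases u) auto

text \<open>\<open>remdups_adj (map fst u)\<close> lists the syllables of \<open>u\<close>. Each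
  syllable multiplies by a series in one variable, so it supplies at most one letter of a monomial
  without adjacent repetitions. With too few syllables, or just enough but a wrong first one, the
  monomial cannot arise.\<close>

lemma magnus_eq_0:
  assumes "distinct_adj \<mu>"
    "length (remdups_adj (map fst u)) < length \<mu> \<or>
     u \<noteq> [] \<and> length (remdups_adj (map fst u)) = length \<mu> \<and> hd \<mu> \<noteq> fst (hd u)"
  shows "magnus u \<mu> = 0"
  using assms
proof (induction u arbitrary: \<mu>)
  case Nil
  then show ?case by (auto simp: magnus_one_def)
next
  case (Cons l u)
  note prems = Cons.prems [unfolded length_remdups_adj_map_fst list.sel]
  have ne: "\<mu> \<noteq> []" using prems(2) by (auto split: if_splits)
  have 1: "magnus u \<mu> = 0"
    by (rule Cons.IH [OF prems(1)]) (use prems(2) in \<open>auto split: if_splits\<close>)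
  show ?case
  proof (cases "hd \<mu> = fst l")
    case False
    then show ?thesis using 1 by (simp add: lmul_other)
  next
    case True
    then obtain \<nu> where \<mu>: "\<mu> = fst l # \<nu>" using ne by (cases \<mu>) auto
    have \<nu>: "distinct_adj \<nu>" "\<nu> = [] \<or> hd \<nu> \<noteq> fst l"
      using prems(1) \<mu> by (auto simp: distinct_adj_Cons)
    have "magnus u \<nu> = 0"
    proof (rule Cons.IH [OF \<nu>(1)], cases "u \<noteq> [] \<and> fst (hd u) = fst l")
      case True
      then have "length (remdups_adj (map fst u)) \<le> length \<nu>" "remdups_adj (map fst u) \<noteq> []"
        using prems(2) \<mu> by auto
      then show "length (remdups_adj (map fst u)) < length \<nu> \<or>
          u \<noteq> [] \<and> length (remdups_adj (map fst u)) = length \<nu> \<and> hd \<nu> \<noteq> fst (hd u)"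
        using \<nu>(2) True by (cases \<nu>) auto
    qed (use prems(2) \<mu> in auto)
    then show ?thesis using 1 \<nu> \<mu> by (simp add: lmul_same)
  qed
qed

text \<open>For a reduced word with syllables \<open>x\<^sub>i\<close> to the power \<open>e\<^sub>i\<close>, the coefficient of
  the monomial \<open>x\<^sub>1 \<dots> x\<^sub>n\<close> is the product of the exponents; \<open>k\<close> is the absolute value of the first.\<close>

lemma magnus_syllables:
  assumes "reduced (l # u)"
  shows "\<exists>\<nu> k. remdups_adj (map fst (l # u)) = fst l # \<nu> \<and> magnus (l # u) \<nu> \<noteq> 0 \<and> 0 < k \<and>
    magnus (l # u) (fst l # \<nu>) = (if snd l then k else - k) * magnus (l # u) \<nu>"
  using assms
proof (induction u arbitrary: l)
  case Nil
  then show ?case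
    using lmul_same [of "[]" l magnus_one] lmul_other [of "[]" l magnus_one]
    by (auto simp: magnus_one_def intro!: exI [of _ 1])
next
  case (Cons k u)
  then obtain \<nu> n where IH: "remdups_adj (map fst (k # u)) = fst k # \<nu>" "magnus (k # u) \<nu> \<noteq> 0"
    "0 < n" "magnus (k # u) (fst k # \<nu>) = (if snd k then n else - n) * magnus (k # u) \<nu>"
    using Cons.IH [of k] unfolding reduced_Cons [of l] by blast
  have adj: "distinct_adj (fst k # \<nu>)" using IH(1) by (metis distinct_adj_remdups_adj)
  show ?case
  proof (cases "fst l = fst k")
    case True
    \<comment> \<open>Reducedness excludes the inverse letter, so \<open>l\<close> prolongs the
      first syllable and the absolute value of its exponent grows to \<open>n + 1\<close>.\<close>
    then have "l = k" using Cons.prems by (auto simp: reduced_Cons letter_inv_def prod_eq_iff)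
    moreover have "\<nu> = [] \<or> hd \<nu> \<noteq> fst k" using adj by (auto simp: distinct_adj_Cons)
    ultimately show ?thesis
      using IH lmul_same [of \<nu> l "magnus (k # u)"] lmul_other [of \<nu> l "magnus (k # u)"]
      by (intro exI [of _ \<nu>] exI [of _ "n + 1"]) (auto simp: algebra_simps)
  next
    case False
    \<comment> \<open>Here \<open>l\<close> opens a new syllable, of exponent 1 up to sign; the
      longer monomial does not occur before \<open>l\<close> is multiplied in.\<close>
    have "magnus (k # u) (fst l # fst k # \<nu>) = 0"
      using adj False IH(1) by (intro magnus_eq_0) auto
    then show ?thesis
      using IH False lmul_same [of "fst k # \<nu>" l "magnus (k # u)"]
        lmul_other [of "fst k # \<nu>" l "magnus (k # u)"]
      by (intro exI [of _ "fst k # \<nu>"] exI [of _ 1]) (auto simp: remdups_adj_Cons)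
  qed
qed

lemma magnus_eq_one:
  assumes "reduced u" "magnus u = magnus_one"
  shows "u = []"
proof (cases u)
  case (Cons l v)
  then obtain \<nu> k where "0 < k" "magnus u \<nu> \<noteq> 0"
    "magnus u (fst l # \<nu>) = (if snd l then k else - k) * magnus u \<nu>"
    using magnus_syllables [of l v] assms(1) by auto
  then show ?thesis using assms(2) by (auto simp: magnus_one_def split: if_splits)
qed

section \<open>Formal inverses and free reduction\<close>

definition winv :: "'x letter list \<Rightarrow> 'x letter list" where
  "winv u = rev (map letter_inv u)"

lemma free_reduce_append_cong:
  assumes "free_reduce u = free_reduce u'" "free_reduce v = free_reduce v'"
  shows "free_reduce (u @ v) = free_reduce (u' @ v')"
proof -
  have "free_reduce (u @ v) = foldr cons_letter (free_reduce u) (free_reduce v)"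
    for u v :: "'a letter list"
    using foldr_foldr_cons_letter [of "free_reduce v" u "[]"] reduced_foldr [of "[]" v]
    by (simp add: free_reduce_def)
  then show ?thesis using assms by metis
qed

lemma free_reduce_idem [simp]: "free_reduce (free_reduce u) = free_reduce u"
  by (intro free_reduce_reduced) (simp add: free_reduce_def reduced_foldr)

lemma reduced_free_reduce [simp]: "reduced (free_reduce u)"
  by (simp add: free_reduce_def reduced_foldr)

lemma free_reduce_Nil [simp]: "free_reduce [] = []"
  by (simp add: free_reduce_def)

lemma winv_simps [simp]:
  "winv [] = []" "winv (u @ v) = winv v @ winv u" "winv (winv u) = u"
  "winv (l # u) = winv u @ [letter_inv l]"
  by (simp_all add: winv_def rev_map o_def)

lemma free_reduce_cancel_pair: "free_reduce (letter_inv l # l # u) = free_reduce u"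
  using cons_letter_inv [of "free_reduce u" l] by (simp add: free_reduce_def reduced_foldr)

lemma free_reduce_winv_left [simp]: "free_reduce (winv u @ u) = []"
proof (induction u)
  case (Cons l u)
  have "free_reduce (winv u @ (letter_inv l # l # u)) = free_reduce (winv u @ u)"
    by (intro free_reduce_append_cong free_reduce_cancel_pair) simp
  then show ?case using Cons by simp
qed simp

lemma free_reduce_winv_right [simp]: "free_reduce (u @ winv u) = []"
  using free_reduce_winv_left [of "winv u"] by simp

lemma magnus_inject:
  assumes "reduced u" "reduced v" "magnus u = magnus v"
  shows "u = v"
proof -
  have "magnus (winv u @ v) = magnus (winv u @ u)"
    using assms(3) by (simp add: magnus_append)
  also have "\<dots> = magnus_one"
    by (metis free_reduce_winv_left magnus_Nil magnus_free_reduce)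
  finally have "free_reduce (winv u @ v) = []"
    by (intro magnus_eq_one) auto
  then have "free_reduce (u @ (winv u @ v)) = free_reduce (u @ [])"
    by (intro free_reduce_append_cong) auto
  moreover have "free_reduce ((u @ winv u) @ v) = free_reduce ([] @ v)"
    by (intro free_reduce_append_cong) auto
  ultimately show ?thesis using assms by (simp add: free_reduce_reduced)
qed

subsection \<open>Tiles from finite-index subgroups\<close>

text \<open>On \<open>F\<close> the map \<open>h\<close> factors through \<open>g\<close>, and the
  factor map is not injective. This makes the measure of the tiling induction decrease.\<close>

lemma card_image_less_if_coarser:
  assumes "finite F"
    and coarser: "\<And>x y. x \<in> F \<Longrightarrow> y \<in> F \<Longrightarrow> g x = g y \<Longrightarrow> h x = h y"
    and "x0 \<in> F" "y0 \<in> F" "h x0 = h y0" "g x0 \<noteq> g y0"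
  shows "card (h ` F) < card (g ` F)"
proof -
  define k where "k c = h (SOME x. x \<in> F \<and> g x = c)" for c
  have k: "k (g x) = h x" if "x \<in> F" for x
  proof -
    have "(SOME y. y \<in> F \<and> g y = g x) \<in> F \<and> g (SOME y. y \<in> F \<and> g y = g x) = g x"
      by (rule someI [of _ x]) (simp add: that)
    then show ?thesis unfolding k_def using coarser that by blast
  qed
  then have "h ` F = k ` g ` F" by (auto simp: image_iff)
  moreover have "\<not> inj_on k (g ` F)" using assms(3-) k by (auto simp: inj_on_def)
  ultimately show ?thesis
    using assms(1) card_image_le [of "g ` F" k] eq_card_imp_inj_on [of "g ` F" k]
    by (metis finite_imageI le_neq_implies_less)
qed

context group
begin

lemma mult_inv_mult_cancel [simp]: "x \<in> carrier G \<Longrightarrow> y \<in> carrier G \<Longrightarrow> x \<otimes> (inv x \<otimes> y) = y"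
  and inv_mult_mult_cancel [simp]: "x \<in> carrier G \<Longrightarrow> y \<in> carrier G \<Longrightarrow> inv x \<otimes> (x \<otimes> y) = y"
  by (simp_all flip: m_assoc)

lemma r_coset_eq_iff:
  assumes "subgroup H G" "x \<in> carrier G" "y \<in> carrier G"
  shows "H #> x = H #> y \<longleftrightarrow> x \<otimes> inv y \<in> H"
proof
  assume "H #> x = H #> y"
  then have "x \<in> H #> y" using rcos_self [of x H] assms by simp
  then show "x \<otimes> inv y \<in> H" using assms
    by (auto simp: r_coset_def m_assoc subgroup.mem_carrier [OF assms(1)])
next
  assume "x \<otimes> inv y \<in> H"
  then have "x \<in> H #> y"
    using assms by (auto simp: r_coset_def m_assoc intro!: bexI [of _ "x \<otimes> inv y"])
  then show "H #> x = H #> y" using repr_independence [of x H y] assms by auto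
qed

lemma translates_eq:
  assumes "d \<otimes> k \<otimes> f = d' \<otimes> k' \<otimes> f'"
    and car: "d \<in> carrier G" "k \<in> carrier G" "f \<in> carrier G"
      "d' \<in> carrier G" "k' \<in> carrier G" "f' \<in> carrier G"
  shows "f \<otimes> inv f' = inv (d \<otimes> k) \<otimes> (d' \<otimes> k')"
    and "inv d \<otimes> d' = k \<otimes> (f \<otimes> inv f') \<otimes> inv k'"
proof -
  have "f = inv (d \<otimes> k) \<otimes> (d \<otimes> k \<otimes> f)" using car by simp
  then have f: "f = inv (d \<otimes> k) \<otimes> (d' \<otimes> k' \<otimes> f')" unfolding assms(1) .
  show "f \<otimes> inv f' = inv (d \<otimes> k) \<otimes> (d' \<otimes> k')"
    by (subst f) (use car in \<open>simp add: m_assoc\<close>)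
  then show "inv d \<otimes> d' = k \<otimes> (f \<otimes> inv f') \<otimes> inv k'"
    using car by (simp add: m_assoc inv_mult_group)
qed

text \<open>\<open>H <#> F\<close> is the disjoint union of the translates of \<open>K <#> F\<close>
  by representatives \<open>d\<close> of the cosets of \<open>K\<close> in \<open>H\<close>, so
  \<open>T\<close> tiles it with centres \<open>d \<otimes> c\<close>. Disjointness is where
  \<open>sep\<close> enters: a common point of two translates puts some
  \<open>f \<otimes> inv f'\<close> into \<open>H\<close>, hence into \<open>K\<close>, and then
  both representatives lie in the same coset.\<close>

lemma tile_extend_subgroup:
  assumes H: "subgroup H G" and K: "subgroup K G" "K \<subseteq> H" and F: "F \<subseteq> carrier G"
    and sep: "\<And>f g. f \<in> F \<Longrightarrow> g \<in> F \<Longrightarrow> f \<otimes> inv g \<in> H \<Longrightarrow> f \<otimes> inv g \<in> K"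
    and C: "C \<subseteq> K" and T: "T \<subseteq> carrier G"
    and bij: "bij_betw (\<lambda>(c, t). c \<otimes> t) (C \<times> T) (K <#> F)"
  shows "\<exists>C' \<subseteq> H. bij_betw (\<lambda>(c, t). c \<otimes> t) (C' \<times> T) (H <#> F)"
proof -
  define rep where "rep h = (SOME d. d \<in> H \<and> inv d \<otimes> h \<in> K)" for h
  have rep: "rep h \<in> H \<and> inv (rep h) \<otimes> h \<in> K" if "h \<in> H" for h
    unfolding rep_def
  proof (rule someI [of _ h])
    show "h \<in> H \<and> inv h \<otimes> h \<in> K"
      using that subgroup.one_closed [OF K(1)] subgroup.mem_carrier [OF H] by simp
  qed
  note [simp] = subgroup.mem_carrier [OF H] subgroup.mem_carrier [OF K(1)]
    subgroup.m_closed [OF H] subgroup.m_closed [OF K(1)]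
    subgroup.m_inv_closed [OF H] subgroup.m_inv_closed [OF K(1)]
  have KH: "k \<in> H" if "k \<in> K" for k using that K by auto
  have rep_eq: "rep h = rep h'" if "h \<in> H" "h' \<in> H" "inv h \<otimes> h' \<in> K" for h h'
  proof -
    have "inv d \<otimes> h \<in> K \<longleftrightarrow> inv d \<otimes> h' \<in> K" if "d \<in> H" for d
    proof
      assume "inv d \<otimes> h \<in> K"
      then have "(inv d \<otimes> h) \<otimes> (inv h \<otimes> h') \<in> K" using \<open>inv h \<otimes> h' \<in> K\<close> by simp
      then show "inv d \<otimes> h' \<in> K" using that \<open>h \<in> H\<close> \<open>h' \<in> H\<close>
        by (simp add: m_assoc)
    next
      assume "inv d \<otimes> h' \<in> K"
      then have "(inv d \<otimes> h') \<otimes> inv (inv h \<otimes> h') \<in> K" using \<open>inv h \<otimes> h' \<in> K\<close> by simp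
      also have "(inv d \<otimes> h') \<otimes> inv (inv h \<otimes> h') = inv d \<otimes> h"
        using that \<open>h \<in> H\<close> \<open>h' \<in> H\<close> by (simp add: inv_mult_group m_assoc)
      finally show "inv d \<otimes> h \<in> K" .
    qed
    then show ?thesis unfolding rep_def by metis
  qed
  let ?D = "rep ` H"
  let ?C = "{d \<otimes> c | d c. d \<in> ?D \<and> c \<in> C}"
  have D: "d \<in> H" "rep d = d" if d: "d \<in> ?D" for d
  proof -
    obtain h where h: "h \<in> H" "d = rep h" using d by auto
    then show "d \<in> H" using rep by simp
    show "rep d = d" unfolding h(2) by (rule rep_eq) (use h rep [of h] in simp_all)
  qed
  have CH: "?C \<subseteq> H"
  proof clarify
    fix h c assume "h \<in> H" "c \<in> C"
    then have "rep h \<in> H" "c \<in> H" using rep C KH by auto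
    then show "rep h \<otimes> c \<in> H" by simp
  qed
  have split: "\<exists>f \<in> F. \<exists>k \<in> K. c \<otimes> t = k \<otimes> f" if "c \<in> C" "t \<in> T" for c t
  proof -
    have "(\<lambda>(c, t). c \<otimes> t) (c, t) \<in> K <#> F"
      by (rule bij_betw_apply [OF bij]) (use that in simp)
    then show ?thesis by (auto simp: set_mult_def)
  qed
  have *: "d = d'" "c = c'" "t = t'"
    if h: "d \<in> ?D" "d' \<in> ?D" "c \<in> C" "c' \<in> C" "t \<in> T" "t' \<in> T"
      "d \<otimes> c \<otimes> t = d' \<otimes> c' \<otimes> t'" for d d' c c' t t'
  proof -
    obtain f k where f: "f \<in> F" "k \<in> K" "c \<otimes> t = k \<otimes> f" using split [OF h(3,5)] by blast
    obtain f' k' where f': "f' \<in> F" "k' \<in> K" "c' \<otimes> t' = k' \<otimes> f'" using split [OF h(4,6)] by blast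
    have car: "d \<in> H" "d' \<in> H" "c \<in> K" "c' \<in> K" "t \<in> carrier G" "t' \<in> carrier G"
      "f \<in> carrier G" "f' \<in> carrier G"
      using h(1-6) D(1) C T f(1) f'(1) F by blast+
    have carG: "d \<in> carrier G" "d' \<in> carrier G" "c \<in> carrier G" "c' \<in> carrier G"
      "k \<in> carrier G" "k' \<in> carrier G"
      using car(1-4) f(2) f'(2) by simp_all
    have "d \<otimes> k \<otimes> f = d \<otimes> c \<otimes> t"
      unfolding m_assoc [OF carG(1,5) car(7)] m_assoc [OF carG(1,3) car(5)] f(3) ..
    moreover have "d' \<otimes> k' \<otimes> f' = d' \<otimes> c' \<otimes> t'"
      unfolding m_assoc [OF carG(2,6) car(8)] m_assoc [OF carG(2,4) car(6)] f'(3) ..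
    ultimately have "d \<otimes> k \<otimes> f = d' \<otimes> k' \<otimes> f'" using h(7) by simp
    from translates_eq [OF this] have trans:
      "f \<otimes> inv f' = inv (d \<otimes> k) \<otimes> (d' \<otimes> k')" "inv d \<otimes> d' = k \<otimes> (f \<otimes> inv f') \<otimes> inv k'"
      using carG car(7,8) by auto
    have "inv (d \<otimes> k) \<otimes> (d' \<otimes> k') \<in> H"
      using car(1,2) KH [OF f(2)] KH [OF f'(2)] by simp
    then have fK: "f \<otimes> inv f' \<in> K" unfolding trans(1) [symmetric] by (rule sep [OF f(1) f'(1)])
    have "inv d \<otimes> d' \<in> K" unfolding trans(2) using fK f(2) f'(2) by simp
    then show d: "d = d'"
      using rep_eq [of d d'] D(2) [OF h(1)] D(2) [OF h(2)] car(1,2) by simp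
    have "c \<otimes> t = c' \<otimes> t'"
      using h(7) carG car(5,6) unfolding d by (simp add: m_assoc)
    then have "(c, t) = (c', t')"
      using inj_onD [OF bij_betw_imp_inj_on [OF bij], of "(c, t)" "(c', t')"] h(3-6) by simp
    then show "c = c'" "t = t'" by auto
  qed
  have "bij_betw (\<lambda>(c, t). c \<otimes> t) (?C \<times> T) (H <#> F)"
    unfolding bij_betw_def
  proof
    show "inj_on (\<lambda>(c, t). c \<otimes> t) (?C \<times> T)"
    proof (rule inj_onI)
      fix p q
      assume p: "p \<in> ?C \<times> T" and q: "q \<in> ?C \<times> T"
        and eq: "(\<lambda>(c, t). c \<otimes> t) p = (\<lambda>(c, t). c \<otimes> t) q"
      obtain d c t where p: "p = (d \<otimes> c, t)" "d \<in> ?D" "c \<in> C" "t \<in> T" using p by blast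
      obtain d' c' t' where q: "q = (d' \<otimes> c', t')" "d' \<in> ?D" "c' \<in> C" "t' \<in> T" using q by blast
      have "d \<otimes> c \<otimes> t = d' \<otimes> c' \<otimes> t'" using eq p(1) q(1) by simp
      from * [OF p(2) q(2) p(3) q(3) p(4) q(4) this] show "p = q" using p(1) q(1) by simp
    qed
    show "(\<lambda>(c, t). c \<otimes> t) ` (?C \<times> T) = H <#> F"
    proof (intro equalityI subsetI)
      fix y assume "y \<in> (\<lambda>(c, t). c \<otimes> t) ` (?C \<times> T)"
      then obtain p where p: "p \<in> ?C \<times> T" "y = (\<lambda>(c, t). c \<otimes> t) p" by (rule imageE)
      obtain d c t where y: "d \<in> ?D" "c \<in> C" "t \<in> T" "p = (d \<otimes> c, t)" using p(1) by blast
      then have y4: "y = d \<otimes> c \<otimes> t" using p(2) by simp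
      obtain f k where f: "f \<in> F" "k \<in> K" "c \<otimes> t = k \<otimes> f" using split [OF y(2,3)] by blast
      have "d \<in> carrier G" "k \<in> carrier G" "f \<in> carrier G" "c \<in> carrier G" "t \<in> carrier G"
        using y(2,3) f(1,2) D(1) [OF y(1)] C T F by auto
      then have "y = (d \<otimes> k) \<otimes> f" using y4 f(3) by (simp add: m_assoc)
      moreover have "d \<otimes> k \<in> H" using D(1) [OF y(1)] KH f by simp
      ultimately show "y \<in> H <#> F" using f unfolding set_mult_def by blast
    next
      fix y assume "y \<in> H <#> F"
      then obtain h f where y: "h \<in> H" "f \<in> F" "y = h \<otimes> f" by (auto simp: set_mult_def)
      then have k: "inv (rep h) \<otimes> h \<in> K" "rep h \<in> H" using rep by auto
      then have "inv (rep h) \<otimes> h \<otimes> f \<in> K <#> F" using y unfolding set_mult_def by blast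
      then obtain c t where ct: "c \<in> C" "t \<in> T" "inv (rep h) \<otimes> h \<otimes> f = c \<otimes> t"
        using bij_betw_imp_surj_on [OF bij, symmetric] by auto
      have "y = rep h \<otimes> (inv (rep h) \<otimes> h \<otimes> f)"
      proof -
        have "h \<in> carrier G" "rep h \<in> carrier G" "f \<in> carrier G" using y(1,2) k(2) F by auto
        then show ?thesis unfolding y(3) by (simp add: m_assoc)
      qed
      also have "\<dots> = rep h \<otimes> c \<otimes> t"
      proof -
        have "rep h \<in> carrier G" "c \<in> carrier G" "t \<in> carrier G" using k(2) ct(1,2) C T by auto
        then show ?thesis unfolding ct(3) by (simp add: m_assoc)
      qed
      finally have "y = (\<lambda>(c, t). c \<otimes> t) (rep h \<otimes> c, t)" by simp
      then show "y \<in> (\<lambda>(c, t). c \<otimes> t) ` (?C \<times> T)"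
      proof (rule image_eqI)
        show "(rep h \<otimes> c, t) \<in> ?C \<times> T" using y(1) ct(1,2) by blast
      qed
    qed
  qed
  then show ?thesis using CH by blast
qed

text \<open>The measure is the number of elements of \<open>F\<close> minus the number of cosets of
  \<open>H\<close> that they occupy. If it is zero, \<open>F\<close> itself is the tile, with
  centres \<open>H\<close>. Otherwise the quotients lying in \<open>H\<close> generate a nontrivial
  \<open>K\<close>, and \<open>F\<close> is enlarged to \<open>F'\<close> with
  \<open>N <#> F' = K <#> F\<close> for a proper subgroup \<open>N\<close> of
  \<open>K\<close>.\<close>

lemma tile_relative_to_subgroup:
  assumes P: "\<And>A. A \<subseteq> carrier G \<Longrightarrow> finite A \<Longrightarrow> generate G A \<noteq> {\<one>} \<Longrightarrow>
      \<exists>N D. subgroup N G \<and> N \<subset> generate G A \<and> finite D \<and> D \<subseteq> carrier G \<and> generate G A = N <#> D"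
    and "subgroup H G" "F \<subseteq> carrier G" "finite F"
  shows "\<exists>C T. C \<subseteq> H \<and> T \<subseteq> carrier G \<and> finite T \<and> F \<subseteq> T \<and>
    bij_betw (\<lambda>(c, t). c \<otimes> t) (C \<times> T) (H <#> F)"
  using assms(2-)
proof (induction "card F - card ((\<lambda>f. H #> f) ` F)" arbitrary: H F rule: less_induct)
  case less
  note H = less.prems(1) and F = less.prems(2) and fin = less.prems(3)
  show ?case
  proof (cases "inj_on (\<lambda>f. H #> f) F")
    case True
    have "inj_on (\<lambda>(c, t). c \<otimes> t) (H \<times> F)"
    proof (clarsimp simp: inj_on_def)
      fix c t c' t' assume h: "c \<in> H" "t \<in> F" "c' \<in> H" "t' \<in> F" "c \<otimes> t = c' \<otimes> t'"
      have car: "c \<in> carrier G" "c' \<in> carrier G" "t \<in> carrier G" "t' \<in> carrier G"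
        using h F subgroup.mem_carrier [OF H] by auto
      have "t \<otimes> inv t' = inv c \<otimes> c'"
      proof -
        have "t = inv c \<otimes> (c' \<otimes> t')" using h car by (metis inv_solve_left m_closed)
        then show ?thesis using car by (simp add: m_assoc)
      qed
      also have "\<dots> \<in> H" using h subgroup.m_closed [OF H] subgroup.m_inv_closed [OF H] by simp
      finally have "H #> t = H #> t'" using r_coset_eq_iff [OF H] car by simp
      then have "t = t'" using True h by (auto simp: inj_on_def)
      then show "c = c' \<and> t = t'" using h car by simp
    qed
    then have "bij_betw (\<lambda>(c, t). c \<otimes> t) (H \<times> F) (H <#> F)"
      by (auto simp: bij_betw_def set_mult_def)
    then show ?thesis using F fin by blast
  next
    case False
    let ?A = "{f \<otimes> inv g | f g. f \<in> F \<and> g \<in> F \<and> f \<otimes> inv g \<in> H}"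
    have A: "?A \<subseteq> carrier G" "?A \<subseteq> H" using F by auto
    have "finite ?A" using fin
      by (rule_tac finite_subset [of _ "(\<lambda>(f, g). f \<otimes> inv g) ` (F \<times> F)"]) auto
    obtain f0 g0 where fg0: "f0 \<in> F" "g0 \<in> F" "H #> f0 = H #> g0" "f0 \<noteq> g0"
      using False by (auto simp: inj_on_def)
    then have fgA: "f0 \<otimes> inv g0 \<in> ?A"
      using r_coset_eq_iff [OF H, of f0 g0] F by auto
    have "f0 \<otimes> inv g0 \<noteq> \<one>" using fg0 F by (metis inv_equality inv_inv subsetD inv_closed)
    let ?K = "generate G ?A"
    have K: "subgroup ?K G" "?K \<subseteq> H"
      using generate_is_subgroup [OF A(1)] generate_subgroup_incl [OF A(2) H] by auto
    have "f0 \<otimes> inv g0 \<in> ?K" using fgA by (rule generate.incl)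
    then have "?K \<noteq> {\<one>}" using \<open>f0 \<otimes> inv g0 \<noteq> \<one>\<close> by auto
    then obtain N D where N: "subgroup N G" "N \<subset> ?K" and D: "finite D" "D \<subseteq> carrier G"
      and KND: "?K = N <#> D" using P [OF A(1) \<open>finite ?A\<close>] by blast
    let ?q = "\<lambda>y. N #> y"
    define Y where "Y = D <#> F"
    have "finite Y" "Y \<subseteq> carrier G" using D fin F by (auto simp: Y_def set_mult_def)
    have KF: "?K <#> F = N <#> Y"
      using set_mult_assoc [of N D F] subgroup.subset [OF N(1)] D F by (simp add: KND Y_def)
    define \<C> where "\<C> = ?q ` Y - ?q ` F"
    define pick where "pick c = (SOME y. y \<in> Y \<and> ?q y = c)" for c
    have pick: "pick c \<in> Y \<and> ?q (pick c) = c" if "c \<in> \<C>" for c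
      unfolding pick_def by (rule someI_ex) (use that in \<open>auto simp: \<C>_def\<close>)
    define F' where "F' = F \<union> pick ` \<C>"
    have finC: "finite \<C>" using \<open>finite Y\<close> by (simp add: \<C>_def)
    have F': "F' \<subseteq> carrier G" "finite F'"
      using F fin finC pick \<open>Y \<subseteq> carrier G\<close> by (auto simp: F'_def)
    have FKF: "F \<subseteq> ?K <#> F"
      using F subgroup.one_closed [OF K(1)] by (force simp: set_mult_def)
    have qF': "?q ` F' = ?q ` F \<union> \<C>" using pick by (force simp: F'_def image_Un image_image)
    have union: "N <#> Z = \<Union> (?q ` Z)" for Z by (auto simp: set_mult_def r_coset_def)
    have NF: "N <#> F' = ?K <#> F"
    proof -
      have "\<Union> (?q ` F) \<subseteq> N <#> Y"
      proof -
        have "N <#> F \<subseteq> ?K <#> F" using N(2) by (auto simp: set_mult_def)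
        then show ?thesis using KF union by simp
      qed
      moreover have "\<Union> (?q ` Y) \<subseteq> \<Union> (?q ` F \<union> \<C>)" "\<Union> \<C> \<subseteq> \<Union> (?q ` Y)"
        by (auto simp: \<C>_def)
      ultimately show ?thesis unfolding KF union qF' by auto
    qed
    \<comment> \<open>Each picked point lies in a new coset of \<open>N\<close>, so it raises both
      terms alike. Since \<open>N\<close> misses some generator of \<open>K\<close>, it separates
      two points of \<open>F\<close> that share a coset of \<open>H\<close>.\<close>
    have "card F' - card (?q ` F') < card F - card ((\<lambda>f. H #> f) ` F)"
    proof -
      have "card F' \<le> card F + card \<C>"
        unfolding F'_def using card_Un_le [of F "pick ` \<C>"] card_image_le [OF finC, of pick] by linarith
      moreover have "card (?q ` F') = card (?q ` F) + card \<C>"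
        unfolding qF' using fin finC by (intro card_Un_disjoint) (auto simp: \<C>_def)
      moreover have "\<not> ?A \<subseteq> N" using generate_subgroup_incl [of ?A N] N by auto
      then obtain f1 g1 where fg1: "f1 \<in> F" "g1 \<in> F" "f1 \<otimes> inv g1 \<in> H" "f1 \<otimes> inv g1 \<notin> N"
        by auto
      have "card ((\<lambda>f. H #> f) ` F) < card (?q ` F)"
      proof (rule card_image_less_if_coarser [OF fin])
        fix x y assume xy: "x \<in> F" "y \<in> F" "N #> x = N #> y"
        then have "x \<otimes> inv y \<in> N" using r_coset_eq_iff [OF N(1)] F by auto
        then show "H #> x = H #> y" using r_coset_eq_iff [OF H, of x y] xy F N(2) K(2) by blast
      next
        show "f1 \<in> F" "g1 \<in> F" by fact+
        show "H #> f1 = H #> g1" "N #> f1 \<noteq> N #> g1"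
          using fg1 r_coset_eq_iff [OF H, of f1 g1] r_coset_eq_iff [OF N(1), of f1 g1] F by blast+
      qed
      moreover have "card (?q ` F) \<le> card F" using fin by (rule card_image_le)
      ultimately show ?thesis by linarith
    qed
    from less.hyps [OF this N(1) F'] obtain C T where CT: "C \<subseteq> N" "T \<subseteq> carrier G" "finite T"
      "F' \<subseteq> T" "bij_betw (\<lambda>(c, t). c \<otimes> t) (C \<times> T) (?K <#> F)"
      unfolding NF by auto
    have sep: "f \<otimes> inv g \<in> ?K" if "f \<in> F" "g \<in> F" "f \<otimes> inv g \<in> H" for f g
      using that by (intro generate.incl) auto
    have "C \<subseteq> ?K" using CT N by auto
    from tile_extend_subgroup [OF H K F sep this CT(2,5)] show ?thesis
      using CT(2-4) by (auto simp: F'_def)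
  qed
qed

lemma monotileable_if_locally_finite_index:
  assumes P: "\<And>A. A \<subseteq> carrier G \<Longrightarrow> finite A \<Longrightarrow> generate G A \<noteq> {\<one>} \<Longrightarrow>
      \<exists>N D. subgroup N G \<and> N \<subset> generate G A \<and> finite D \<and> D \<subseteq> carrier G \<and> generate G A = N <#> D"
  shows "monotileable G"
  unfolding monotileable_def
proof (intro allI impI)
  fix F assume F: "F \<subseteq> carrier G" "finite F"
  \<comment> \<open>This makes the set nonempty, so that its product with the whole group is the
    whole group.\<close>
  let ?F = "insert \<one> F"
  have "?F \<subseteq> carrier G" "finite ?F" using F by auto
  then have "\<exists>C T. C \<subseteq> carrier G \<and> T \<subseteq> carrier G \<and> finite T \<and> ?F \<subseteq> T \<and>
      bij_betw (\<lambda>(c, t). c \<otimes> t) (C \<times> T) (carrier G <#> ?F)"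
    by (rule tile_relative_to_subgroup [OF _ subgroup_self, rotated]) (rule P)
  then obtain C T where
    CT: "C \<subseteq> carrier G" "T \<subseteq> carrier G" "finite T" "?F \<subseteq> T"
      "bij_betw (\<lambda>(c, t). c \<otimes> t) (C \<times> T) (carrier G <#> ?F)"
    by blast
  have car: "carrier G <#> ?F = carrier G"
    using F by (force simp: set_mult_def)
  have inj: "c = c' \<and> t = t'" if "c \<in> C" "c' \<in> C" "t \<in> T" "t' \<in> T" "c \<otimes> t = c' \<otimes> t'" for c c' t t'
    using bij_betw_imp_inj_on [OF CT(5)] that by (auto simp: inj_on_def)
  have "disjoint_family_on (\<lambda>g. g <# T) C"
    using inj by (fastforce simp: disjoint_family_on_def l_coset_def)
  moreover have "(\<Union>g\<in>C. g <# T) = carrier G"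
    using bij_betw_imp_surj_on [OF CT(5)] unfolding car by (force simp: l_coset_def)
  ultimately show "\<exists>T. finite T \<and> F \<subseteq> T \<and> tile G T"
    unfolding tile_def using CT by blast
qed

end

subsection \<open>Words acting on a set\<close>

locale word_action =
  fixes act :: "'v \<Rightarrow> 'x letter \<Rightarrow> 'v"
  assumes act_letter_inv [simp]: "act (act v l) (letter_inv l) = v"
begin

lemma act_letter_inv' [simp]: "act (act v (letter_inv l)) l = v"
  using act_letter_inv [of v "letter_inv l"] by simp

text \<open>The unoriented edge crossed by the letter \<open>l\<close> at \<open>v\<close> is named by its
  positively labelled orientation.\<close>

definition edge :: "'v \<Rightarrow> 'x letter \<Rightarrow> 'v \<times> 'x" where
  "edge v l = (if snd l then v else act v l, fst l)"

definition val :: "('v \<times> 'x \<Rightarrow> int) \<Rightarrow> 'v \<Rightarrow> 'x letter \<Rightarrow> int" where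
  "val f v l = (if snd l then f (edge v l) else - f (edge v l))"

primrec acts :: "'v \<Rightarrow> 'x letter list \<Rightarrow> 'v" where
  "acts v [] = v"
| "acts v (l # u) = acts (act v l) u"

primrec trav :: "'v \<Rightarrow> 'x letter list \<Rightarrow> ('v \<times> 'x) set" where
  "trav v [] = {}"
| "trav v (l # u) = insert (edge v l) (trav (act v l) u)"

primrec fsum :: "('v \<times> 'x \<Rightarrow> int) \<Rightarrow> 'v \<Rightarrow> 'x letter list \<Rightarrow> int" where
  "fsum f v [] = 0"
| "fsum f v (l # u) = val f v l + fsum f (act v l) u"

lemma acts_append [simp]: "acts v (u @ w) = acts (acts v u) w"
  by (induction u arbitrary: v) auto

lemma trav_append [simp]: "trav v (u @ w) = trav v u \<union> trav (acts v u) w"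
  by (induction u arbitrary: v) auto

lemma fsum_append [simp]: "fsum f v (u @ w) = fsum f v u + fsum f (acts v u) w"
  by (induction u arbitrary: v) auto

lemma finite_trav [simp]: "finite (trav v u)"
  by (induction u arbitrary: v) auto

lemma edge_letter_inv [simp]: "edge (act v l) (letter_inv l) = edge v l"
  by (auto simp: edge_def letter_inv_def) (metis act_letter_inv letter_inv_def prod.collapse)+

lemma edge_eq_cases:
  assumes "edge v l = edge v' l'"
  obtains "v' = v" "l' = l" | "v' = act v l" "l' = letter_inv l"
proof (cases "snd l = snd l'")
  case True
  then have "l' = l" using assms by (auto simp: edge_def prod_eq_iff)
  moreover from this have "v' = v"
    using assms by (auto simp: edge_def split: if_splits) (metis act_letter_inv)
  ultimately show ?thesis using that(1) by blast
next
  case False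
  then have l': "l' = letter_inv l" using assms by (auto simp: edge_def letter_inv_def prod_eq_iff)
  moreover have "v' = act v l"
    using assms act_letter_inv' [of v' l] False unfolding l'
    by (auto simp: edge_def letter_inv_def split: if_splits)
  ultimately show ?thesis using that(2) by blast
qed

lemma val_letter_inv [simp]: "val f (act v l) (letter_inv l) = - val f v l"
  unfolding val_def edge_letter_inv by (simp add: letter_inv_def)

lemma fsum_cons_letter [simp]: "fsum f v (cons_letter l u) = val f v l + fsum f (act v l) u"
  by (cases u) auto

lemma acts_cons_letter [simp]: "acts v (cons_letter l u) = acts (act v l) u"
  by (cases u) auto

lemma fsum_free_reduce [simp]: "fsum f v (free_reduce u) = fsum f v u"
  and acts_free_reduce [simp]: "acts v (free_reduce u) = acts v u"
  by (induction u arbitrary: v) (auto simp: free_reduce_def)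

lemma acts_winv [simp]: "acts (acts v u) (winv u) = v"
  by (induction u arbitrary: v) auto

lemma fsum_winv [simp]: "fsum f (acts v u) (winv u) = - fsum f v u"
  by (induction u arbitrary: v) auto

lemma fsum_cong:
  assumes "\<And>e. e \<in> trav v u \<Longrightarrow> f e = g e"
  shows "fsum f v u = fsum g v u"
  using assms by (induction u arbitrary: v) (auto simp: val_def)

lemma fsum_diff: "fsum (\<lambda>e. f e - g e) v u = fsum f v u - fsum g v u"
  by (induction u arbitrary: v) (auto simp: val_def)

lemma val_coboundary:
  assumes "\<And>w x. (w, x) \<in> E \<Longrightarrow> m dvd f (w, x) - (p (act w (x, True)) - p w)" "edge v l \<in> E"
  shows "m dvd val f v l - (p (act v l) - p v)"
proof (cases l)
  case (Pair x b)
  show ?thesis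
  proof (cases b)
    case False
    have "m dvd f (act v l, x) - (p v - p (act v l))"
      using assms(1) [of "act v l" x] assms(2) act_letter_inv [of v l] Pair False
      by (auto simp: edge_def letter_inv_def)
    then have "m dvd - (f (act v l, x) - (p v - p (act v l)))" by (simp only: dvd_minus_iff)
    then show ?thesis using Pair False by (simp add: val_def edge_def algebra_simps)
  qed (use assms Pair in \<open>auto simp: val_def edge_def\<close>)
qed

lemma fsum_coboundary:
  assumes "\<And>w x. (w, x) \<in> E \<Longrightarrow> m dvd f (w, x) - (p (act w (x, True)) - p w)" "trav v u \<subseteq> E"
  shows "m dvd fsum f v u - (p (acts v u) - p v)"
  using assms(2)
proof (induction u arbitrary: v)
  case (Cons l u)
  have "m dvd (val f v l - (p (act v l) - p v)) + (fsum f (act v l) u - (p (acts (act v l) u) - p (act v l)))"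
    using Cons by (intro dvd_add val_coboundary [OF assms(1)]) auto
  then show ?case by (simp add: algebra_simps)
qed simp

end

section \<open>Evaluation of words in a group\<close>

primrec word_eval :: "('a, 'b) monoid_scheme \<Rightarrow> ('x \<Rightarrow> 'a) \<Rightarrow> 'x letter list \<Rightarrow> 'a" where
  "word_eval G \<theta> [] = \<one>\<^bsub>G\<^esub>"
| "word_eval G \<theta> (l # u) =
    (if snd l then \<theta> (fst l) else inv\<^bsub>G\<^esub> \<theta> (fst l)) \<otimes>\<^bsub>G\<^esub> word_eval G \<theta> u"

context group
begin

lemma word_eval_closed [simp]:
  assumes "\<And>x. \<theta> x \<in> carrier G"
  shows "word_eval G \<theta> u \<in> carrier G"
  by (induction u) (use assms in auto)

lemma word_eval_append:
  assumes "\<And>x. \<theta> x \<in> carrier G"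
  shows "word_eval G \<theta> (u @ v) = word_eval G \<theta> u \<otimes> word_eval G \<theta> v"
  by (induction u) (use assms in \<open>auto simp: m_assoc\<close>)

lemma word_eval_cons_letter:
  assumes "\<And>x. \<theta> x \<in> carrier G"
  shows "word_eval G \<theta> (cons_letter l u) = word_eval G \<theta> (l # u)"
  by (cases u) (use assms in \<open>auto simp: letter_inv_def m_assoc [symmetric]\<close>)

lemma word_eval_free_reduce:
  assumes "\<And>x. \<theta> x \<in> carrier G"
  shows "word_eval G \<theta> (free_reduce u) = word_eval G \<theta> u"
  by (induction u) (use assms in \<open>auto simp: free_reduce_def word_eval_cons_letter\<close>)

lemma word_eval_winv:
  assumes "\<And>x. \<theta> x \<in> carrier G"
  shows "word_eval G \<theta> (winv u) = inv (word_eval G \<theta> u)"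
proof -
  have "word_eval G \<theta> (winv u @ u) = \<one>"
    using word_eval_free_reduce [of \<theta> "winv u @ u", OF assms] by simp
  then show ?thesis using assms by (simp add: word_eval_append inv_equality)
qed

end

context word_action
begin

text \<open>By \<open>pot\<close>, \<open>P\<close> maps the labelled graph with edge set
  \<open>E\<close> to the Cayley graph of \<open>G\<close>, so a path in \<open>E\<close> goes to a
  path that reads the same word.\<close>

lemma word_eval_potential:
  assumes "group G" "\<And>x. \<theta> x \<in> carrier G" "\<And>v. P v \<in> carrier G"
    and pot: "\<And>w x. (w, x) \<in> E \<Longrightarrow> P (act w (x, True)) = P w \<otimes>\<^bsub>G\<^esub> \<theta> x"
    and "trav v u \<subseteq> E"
  shows "P (acts v u) = P v \<otimes>\<^bsub>G\<^esub> word_eval G \<theta> u"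
  using assms(5)
proof (induction u arbitrary: v)
  case Nil
  then show ?case using assms by (simp add: group.is_monoid)
next
  case (Cons l u)
  interpret group G by fact
  note [simp] = assms(2,3)
  obtain x b where l: "l = (x, b)" by (cases l)
  have "P (act v l) = P v \<otimes>\<^bsub>G\<^esub> (if snd l then \<theta> (fst l) else inv\<^bsub>G\<^esub> \<theta> (fst l))"
  proof (cases b)
    case False
    have "P v = P (act v l) \<otimes>\<^bsub>G\<^esub> \<theta> x"
      using pot [of "act v l" x] Cons.prems act_letter_inv [of v l] l False
      by (auto simp: edge_def letter_inv_def)
    then have "P v \<otimes>\<^bsub>G\<^esub> inv\<^bsub>G\<^esub> \<theta> x = P (act v l)" by (simp add: m_assoc)
    then show ?thesis using l False by simp
  qed (use pot Cons.prems l in \<open>auto simp: edge_def\<close>)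
  then show ?case using Cons.IH [of "act v l"] Cons.prems by (simp add: m_assoc)
qed

end

subsection \<open>Circles over a finite graph\<close>

text \<open>\<open>R\<close> will be the set of rotations of the relator and \<open>rank\<close>
  their position in the invariant order. The last three assumptions say that the order of two
  relators marked at one vertex persists when both marks move along a common edge: both forwards,
  both backwards, or one each way. This is the stacking.\<close>

locale relator_action = word_action act
  for act :: "'v \<Rightarrow> 'x letter \<Rightarrow> 'v" +
  fixes R :: "'x letter list set" and N :: nat and rank :: "'x letter list \<Rightarrow> nat"
  assumes finite_R: "finite R" and R_nonempty: "R \<noteq> {}" and N_pos: "0 < N"
    and length_R: "u \<in> R \<Longrightarrow> length u = N"
    and rotate1_R: "u \<in> R \<Longrightarrow> rotate1 u \<in> R"
    and unrotate_R: "u \<in> R \<Longrightarrow> last u # butlast u \<in> R"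
    and rotate_R_transitive: "u \<in> R \<Longrightarrow> u' \<in> R \<Longrightarrow> \<exists>i. rotate i u = u'"
    and cyclically_reduced_R: "u \<in> R \<Longrightarrow> hd u \<noteq> letter_inv (last u)"
    and inj_rank: "inj_on rank R"
    and rank_rotate1: "u \<in> R \<Longrightarrow> u' \<in> R \<Longrightarrow> hd u = hd u' \<Longrightarrow> rank u < rank u' \<Longrightarrow>
      rank (rotate1 u) < rank (rotate1 u')"
    and rank_unrotate: "u \<in> R \<Longrightarrow> u' \<in> R \<Longrightarrow> last u = last u' \<Longrightarrow> rank u < rank u' \<Longrightarrow>
      rank (last u # butlast u) < rank (last u' # butlast u')"
    and rank_rotate1_unrotate: "u \<in> R \<Longrightarrow> u' \<in> R \<Longrightarrow> hd u = letter_inv (last u') \<Longrightarrow>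
      rank u < rank u' \<longleftrightarrow> rank (rotate1 u) < rank (last u' # butlast u')"
begin

lemma R_not_Nil: "u \<in> R \<Longrightarrow> u \<noteq> []"
  using length_R N_pos by fastforce

text \<open>A pair \<open>(v, u)\<close> in \<open>circles E\<close> is a circle reading a relator in the
  graph with edge set \<open>E\<close>, with a marked point lying over \<open>v\<close>.\<close>

definition circles :: "('v \<times> 'x) set \<Rightarrow> ('v \<times> 'x letter list) set" where
  "circles E = {(v, u). u \<in> R \<and> acts v u = v \<and> trav v u \<subseteq> E}"

definition step :: "'v \<times> 'x letter list \<Rightarrow> 'v \<times> 'x letter list" where
  "step q = (act (fst q) (hd (snd q)), rotate1 (snd q))"

definition unstep :: "'v \<times> 'x letter list \<Rightarrow> 'v \<times> 'x letter list" where
  "unstep q = (act (fst q) (letter_inv (last (snd q))), last (snd q) # butlast (snd q))"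

definition step_edge :: "'v \<times> 'x letter list \<Rightarrow> 'v \<times> 'x" where
  "step_edge q = edge (fst q) (hd (snd q))"

lemma circles_R: "q \<in> circles E \<Longrightarrow> snd q \<in> R"
  by (auto simp: circles_def)

lemma step_circles: "q \<in> circles E \<Longrightarrow> step q \<in> circles E"
proof -
  assume q: "q \<in> circles E"
  obtain v l u where q': "q = (v, l # u)"
    using q R_not_Nil by (metis circles_R list.exhaust surjective_pairing)
  have "acts (act v l) u = v" "trav v (l # u) \<subseteq> E" using q q' by (auto simp: circles_def)
  then show ?thesis
    using q q' rotate1_R [of "l # u"] by (auto simp: circles_def step_def)
qed

lemma circles_snoc:
  assumes "q \<in> circles E"
  obtains u l v where "q = (act v l, u @ [l])" "acts (act v l) u = v" "unstep q = (v, l # u)"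
proof -
  obtain w u l where q: "q = (w, u @ [l])"
    using assms R_not_Nil by (metis circles_R append_butlast_last_id surjective_pairing)
  then have "act (acts w u) l = w" using assms by (auto simp: circles_def)
  then show ?thesis using that [of "acts w u" l u] q
    by (simp add: unstep_def) (metis act_letter_inv)
qed

lemma unstep_circles: "q \<in> circles E \<Longrightarrow> unstep q \<in> circles E"
proof -
  assume q: "q \<in> circles E"
  then obtain u l v where "q = (act v l, u @ [l])" "acts (act v l) u = v" "unstep q = (v, l # u)"
    by (rule circles_snoc)
  then show ?thesis using q unrotate_R [of "u @ [l]"] by (auto simp: circles_def)
qed

lemma unstep_step: "q \<in> circles E \<Longrightarrow> unstep (step q) = q"
proof -
  assume q: "q \<in> circles E"
  obtain v l u where q': "q = (v, l # u)"
    using q R_not_Nil by (metis circles_R list.exhaust surjective_pairing)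
  then show ?thesis by (simp add: step_def unstep_def)
qed

lemma step_unstep: "q \<in> circles E \<Longrightarrow> step (unstep q) = q"
  by (elim circles_snoc) (auto simp: step_def)

lemma step_edge_in: "q \<in> circles E \<Longrightarrow> step_edge q \<in> E"
proof -
  assume q: "q \<in> circles E"
  obtain v l u where q': "q = (v, l # u)"
    using q R_not_Nil by (metis circles_R list.exhaust surjective_pairing)
  then show ?thesis using q by (auto simp: step_edge_def circles_def)
qed

lemma funpow_step_circles: "q \<in> circles E \<Longrightarrow> (step ^^ i) q \<in> circles E"
  by (induction i) (auto simp: step_circles)

lemma funpow_step:
  "i \<le> length u \<Longrightarrow> (step ^^ i) (v, u) = (acts v (take i u), rotate i u)"
proof (induction i)
  case (Suc i)
  then have "hd (rotate i u) = u ! i" by (subst hd_rotate_conv_nth) auto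
  then show ?case using Suc by (simp add: step_def take_Suc_conv_app_nth)
qed simp

lemma snd_funpow_step: "snd ((step ^^ i) q) = rotate i (snd q)"
  by (induction i) (auto simp: step_def)

lemma funpow_step_N: "q \<in> circles E \<Longrightarrow> (step ^^ N) q = q"
  using funpow_step [of N "snd q" "fst q"] length_R [of "snd q"] by (auto simp: circles_def)

lemma fsum_conv_sum:
  "k \<le> length u \<Longrightarrow> fsum f v (take k u) =
    (\<Sum>i<k. val f (fst ((step ^^ i) (v, u))) (hd (snd ((step ^^ i) (v, u)))))"
proof (induction k)
  case (Suc i)
  then have "hd (rotate i u) = u ! i" by (subst hd_rotate_conv_nth) auto
  then show ?case using Suc by (simp add: funpow_step take_Suc_conv_app_nth)
qed simp

lemma trav_conv_image: "k \<le> length u \<Longrightarrow> trav v (take k u) = (\<lambda>i. step_edge ((step ^^ i) (v, u))) ` {..<k}"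
proof (induction k)
  case (Suc i)
  then have "hd (rotate i u) = u ! i" by (subst hd_rotate_conv_nth) auto
  then show ?case using Suc
    by (simp add: funpow_step take_Suc_conv_app_nth lessThan_Suc step_edge_def)
qed simp

lemma trav_circle:
  assumes "q \<in> circles E"
  shows "trav (fst q) (snd q) = (\<lambda>i. step_edge ((step ^^ i) q)) ` {..<N}"
  using trav_conv_image [of N "snd q" "fst q"] assms length_R [of "snd q"] by (auto simp: circles_def)

lemma fsum_step: "q \<in> circles E \<Longrightarrow> fsum f (fst (step q)) (snd (step q)) = fsum f (fst q) (snd q)"
proof -
  assume q: "q \<in> circles E"
  obtain v l u where q': "q = (v, l # u)"
    using q R_not_Nil by (metis circles_R list.exhaust surjective_pairing)
  then have "acts (act v l) u = v" using q by (auto simp: circles_def)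
  then show ?thesis using q' by (simp add: step_def)
qed

lemma fsum_funpow_step:
  "q \<in> circles E \<Longrightarrow> fsum f (fst ((step ^^ i) q)) (snd ((step ^^ i) q)) = fsum f (fst q) (snd q)"
  by (induction i) (simp_all add: fsum_step [OF funpow_step_circles])

lemma vertex_in:
  assumes "edge v l \<in> E"
  shows "v \<in> fst ` E \<union> (\<lambda>(w, x). act w (x, True)) ` E"
proof (cases "snd l")
  case False
  have "(\<lambda>(w, x). act w (x, True)) (edge v l) = v"
    using False act_letter_inv [of v l] by (cases l) (auto simp: edge_def letter_inv_def)
  then show ?thesis using assms by (metis UnI2 imageI)
qed (use assms in \<open>force simp: edge_def\<close>)

lemma finite_circles: "finite E \<Longrightarrow> finite (circles E)"
proof (rule finite_subset)
  show "circles E \<subseteq> (fst ` E \<union> (\<lambda>(w, x). act w (x, True)) ` E) \<times> R"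
  proof
    fix q assume q: "q \<in> circles E"
    then show "q \<in> (fst ` E \<union> (\<lambda>(w, x). act w (x, True)) ` E) \<times> R"
      using vertex_in [of "fst q" "hd (snd q)" E] step_edge_in [OF q] circles_R [OF q]
      by (cases q) (auto simp: step_edge_def)
  qed
qed (use finite_R in auto)

lemma circles_Diff: "circles (E - {e}) = {q \<in> circles E. e \<notin> trav (fst q) (snd q)}"
  by (auto simp: circles_def)

subsection \<open>The counting inequality of Louder and Wilton\<close>

text \<open>The circles passing through the half-edge \<open>l\<close> at \<open>v\<close>, marked at \<open>v\<close>.\<close>

definition through :: "('v \<times> 'x) set \<Rightarrow> 'v \<Rightarrow> 'x letter \<Rightarrow> 'x letter list set" where
  "through E v l = {u. (v, u) \<in> circles E \<and> (hd u = l \<or> last u = letter_inv l)}"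

text \<open>Moves the mark across the half-edge \<open>l\<close>: forwards if the circle leaves
  along it, backwards if it arrives along it. For members of \<open>through\<close> exactly one of
  the two holds, by cyclic reducedness.\<close>

definition shift :: "'x letter \<Rightarrow> 'x letter list \<Rightarrow> 'x letter list" where
  "shift l u = (if hd u = l then rotate1 u else last u # butlast u)"

lemma shift_through:
  assumes "u \<in> through E v l"
  shows "shift l u \<in> through E (act v l) (letter_inv l)"
proof (cases "hd u = l")
  case True
  have "(v, u) \<in> circles E" using assms by (simp add: through_def)
  with step_circles [OF this] True R_not_Nil [OF circles_R [OF this]] show ?thesis
    by (cases u) (auto simp: through_def shift_def step_def)
next
  case False
  have "(v, u) \<in> circles E" using assms by (simp add: through_def)
  with unstep_circles [OF this] False assms show ?thesis
    by (auto simp: through_def shift_def unstep_def)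
qed

lemma shift_less:
  assumes "u \<in> through E v l" "u' \<in> through E v l" "rank u < rank u'"
  shows "rank (shift l u) < rank (shift l u')"
proof -
  have R: "u \<in> R" "u' \<in> R" using assms circles_R by (auto simp: through_def)
  consider "hd u = l" "hd u' = l" | "hd u = l" "hd u' \<noteq> l" | "hd u \<noteq> l" "hd u' = l" | "hd u \<noteq> l" "hd u' \<noteq> l"
    by blast
  then show ?thesis
  proof cases
    case 1
    then show ?thesis using rank_rotate1 [OF R] assms(3) by (simp add: shift_def)
  next
    case 2
    then show ?thesis using rank_rotate1_unrotate [OF R] assms by (auto simp: shift_def through_def)
  next
    case 3
    then have *: "hd u' = letter_inv (last u)" using assms by (auto simp: through_def)
    \<comment> \<open>The equivalence yields only a weak inequality here. Equality would give a
      rotation of the relator that begins with the inverse of its last letter.\<close>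
    have ne: "rotate1 u' \<noteq> last u # butlast u"
    proof
      assume "rotate1 u' = last u # butlast u"
      then have "last (rotate1 u') = last (last u # butlast u)" "hd (rotate1 u') = last u" by simp_all
      then show False
        using cyclically_reduced_R [OF rotate1_R [OF R(2)]] * R_not_Nil [OF R(2)]
        by (cases u') auto
    qed
    have "rotate1 u' \<in> R" "last u # butlast u \<in> R" using R rotate1_R unrotate_R by auto
    then have "rank (rotate1 u') \<noteq> rank (last u # butlast u)" using ne inj_rank by (auto dest: inj_onD)
    moreover have "\<not> rank (rotate1 u') < rank (last u # butlast u)"
      using rank_rotate1_unrotate [OF R(2,1) *] assms(3) by simp
    ultimately show ?thesis using 3 by (simp add: shift_def)
  next
    case 4
    then show ?thesis using rank_unrotate [OF R] assms by (auto simp: shift_def through_def)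
  qed
qed

lemma shift_le:
  assumes "u \<in> through E v l" "u' \<in> through E v l" "rank (shift l u) \<le> rank (shift l u')"
  shows "rank u \<le> rank u'"
  using shift_less [OF assms(2,1)] assms(3) by (meson leD leI)

text \<open>The top circle of an edge is recorded at the end where it enters the edge, in its own
  direction, although it is compared with circles running either way. So an edge has at most one
  such record.\<close>

definition edge_tops :: "('v \<times> 'x) set \<Rightarrow> ('v \<times> 'x letter list) set" where
  "edge_tops E = {(v, u) \<in> circles E. \<forall>u' \<in> through E v (hd u). rank u' \<le> rank u}"

definition vertex_tops :: "('v \<times> 'x) set \<Rightarrow> ('v \<times> 'x letter list) set" where
  "vertex_tops E = {(v, u) \<in> circles E. \<forall>u'. (v, u') \<in> circles E \<longrightarrow> rank u' \<le> rank u}"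

lemma circles_eqI:
  assumes "(v, u) \<in> circles E" "(v, u') \<in> circles E" "rank u = rank u'"
  shows "u = u'"
  using assms inj_rank circles_R by (auto dest: inj_onD)

lemma hd_through: "(v, u) \<in> circles E \<Longrightarrow> u \<in> through E v (hd u)"
  by (simp add: through_def)

lemma inj_on_step_edge: "inj_on step_edge (edge_tops E)"
proof (rule inj_onI)
  fix q q' assume q: "q \<in> edge_tops E" and q': "q' \<in> edge_tops E" and eq: "step_edge q = step_edge q'"
  obtain v u v' u' where uv: "q = (v, u)" "q' = (v', u')" by (cases q; cases q')
  have c: "(v, u) \<in> circles E" "(v', u') \<in> circles E" using q q' uv by (auto simp: edge_tops_def)
  have "edge v (hd u) = edge v' (hd u')" using eq uv by (simp add: step_edge_def)
  then show "q = q'"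
  proof (cases rule: edge_eq_cases)
    case 1
    then have "u \<in> through E v' (hd u')" "u' \<in> through E v (hd u)"
      using c hd_through by metis+
    then have "rank u = rank u'" using q q' uv by (force simp: edge_tops_def)
    then show ?thesis using circles_eqI c 1 uv by metis
  next
    case 2
    \<comment> \<open>The two tops would run along the edge in opposite directions. Moving the mark
      of one to the other end and comparing both ways identifies them, against cyclic
      reducedness.\<close>
    let ?w = "shift (hd u) u"
    have w: "?w \<in> through E v' (hd u')" using shift_through [OF hd_through [OF c(1)]] 2 by simp
    then have le1: "rank ?w \<le> rank u'" using q' uv by (auto simp: edge_tops_def)
    have u': "u' \<in> through E v' (hd u')" using c hd_through by simp
    have "shift (hd u') u' \<in> through E v (hd u)" using shift_through [OF u'] 2 by simp
    then have le2: "rank (shift (hd u') u') \<le> rank u" using q uv by (auto simp: edge_tops_def)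
    have wR: "u \<in> R" "u' \<in> R" using c circles_R by auto
    have ww: "?w = rotate1 u" by (simp add: shift_def)
    have last_w: "last (rotate1 u) = hd u" using R_not_Nil [OF wR(1)] by (cases u) auto
    have hd_w: "hd (rotate1 u) \<noteq> hd u'"
      using cyclically_reduced_R [OF rotate1_R [OF wR(1)]] last_w 2 by simp
    have "shift (hd u') ?w = u"
      using hd_w ww R_not_Nil [OF wR(1)] by (cases u) (auto simp: shift_def)
    then have "rank u' \<le> rank ?w" using shift_le [OF u' w] le2 by simp
    then have "?w = u'" using le1 inj_rank wR rotate1_R ww by (metis inj_onD order_antisym)
    then show ?thesis using hd_w ww by simp
  qed
qed

lemma vertex_tops_subset: "vertex_tops E \<subseteq> edge_tops E"
  by (auto simp: vertex_tops_def edge_tops_def through_def)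

text \<open>Every circle through the incoming edge also passes the vertex, and \<open>shift\<close>
  keeps the order; so the circle on top at the vertex was already on top of that edge.\<close>

lemma vertex_tops_arrive: "vertex_tops E \<subseteq> step ` edge_tops E"
proof
  fix q assume q: "q \<in> vertex_tops E"
  then have c: "q \<in> circles E" by (auto simp: vertex_tops_def)
  then obtain u l v where q': "q = (act v l, u @ [l])" "unstep q = (v, l # u)" by (rule circles_snoc)
  have b: "(v, l # u) \<in> circles E" using unstep_circles [OF c] q' by simp
  have "rank u' \<le> rank (l # u)" if u': "u' \<in> through E v l" for u'
  proof (rule shift_le [OF u'])
    show "l # u \<in> through E v l" using b by (simp add: through_def)
    have "(act v l, shift l u') \<in> circles E" using shift_through [OF u'] by (simp add: through_def)
    then show "rank (shift l u') \<le> rank (shift l (l # u))"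
      using q q' by (auto simp: vertex_tops_def shift_def)
  qed
  then have "unstep q \<in> edge_tops E" using b q' by (auto simp: edge_tops_def)
  then show "q \<in> step ` edge_tops E" using step_unstep [OF c] by (metis imageI)
qed

definition umax :: "'x letter list" where "umax = (ARG_MAX rank u. u \<in> R)"
definition umin :: "'x letter list" where "umin = (ARG_MIN rank u. u \<in> R)"

lemma umax: "umax \<in> R" "u \<in> R \<Longrightarrow> rank u \<le> rank umax"
proof -
  obtain u0 where "u0 \<in> R" using R_nonempty by auto
  moreover have "rank u \<le> Max (rank ` R)" if "u \<in> R" for u using finite_R that by simp
  ultimately show "umax \<in> R" "u \<in> R \<Longrightarrow> rank u \<le> rank umax"
    using arg_max_nat_lemma [of "\<lambda>u. u \<in> R" u0 rank "Suc (Max (rank ` R))"]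
    by (auto simp: umax_def less_Suc_eq_le)
qed

lemma umin: "umin \<in> R" "u \<in> R \<Longrightarrow> rank umin \<le> rank u"
  using arg_min_nat_lemma [of "\<lambda>u. u \<in> R" _ rank] R_nonempty by (auto simp: umin_def)

text \<open>These stand for the cells. Every orbit of \<open>step\<close> contains one, possibly
  several if the relator is a proper power; both bounds on \<open>card E\<close> use this same
  count, so the multiplicity does no harm.\<close>

definition lifts :: "('v \<times> 'x) set \<Rightarrow> ('v \<times> 'x letter list) set" where
  "lifts E = {q \<in> circles E. snd q = umax}"

lemma lifts_subset: "lifts E \<subseteq> vertex_tops E"
  using umax circles_R by (fastforce simp: lifts_def vertex_tops_def)

text \<open>Follow a circle from a lift of the top relator until it is no longer the top circle at its
  vertex. It arrives there along an edge on which it is still on top. This happens before the next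
  lift of the top relator, since the bottom relator is on top of no edge that is covered twice.\<close>

lemma Louder_Wilton:
  assumes fin: "finite E"
    and twice: "\<And>q. q \<in> circles E \<Longrightarrow> \<exists>q' \<in> circles E. q' \<noteq> q \<and> step_edge q' = step_edge q"
  shows "card (fst ` circles E) + card (lifts E) \<le> card E"
proof -
  let ?V = "vertex_tops E"
  have fc: "finite (circles E)" using finite_circles fin .
  \<comment> \<open>A second passage over the edge, transported to \<open>v\<close> if it runs the
    other way, is a circle through the same half-edge with a relator other than \<open>umin\<close>,
    so it outranks \<open>umin\<close>.\<close>
  have umin_not: "(v, umin) \<notin> edge_tops E" for v
  proof
    assume top: "(v, umin) \<in> edge_tops E"
    then have c: "(v, umin) \<in> circles E" by (auto simp: edge_tops_def)
    then obtain q' where q': "q' \<in> circles E" "q' \<noteq> (v, umin)" "step_edge q' = step_edge (v, umin)"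
      using twice by blast
    obtain v' u' where uv: "q' = (v', u')" by (cases q')
    have u'R: "u' \<in> R" using circles_R q' uv by force
    have "edge v (hd umin) = edge v' (hd u')" using q' uv by (simp add: step_edge_def)
    then have "\<exists>w \<in> through E v (hd umin). w \<noteq> umin"
    proof (cases rule: edge_eq_cases)
      case 1
      then show ?thesis using q' uv by (auto simp: through_def)
    next
      case 2
      have "rotate1 u' \<in> through E v (hd umin)"
        using shift_through [OF hd_through, of v' u' E] q' uv 2 by (simp add: shift_def)
      moreover have "rotate1 u' \<noteq> umin"
      proof
        assume eq: "rotate1 u' = umin"
        have "last (rotate1 u') = hd u'" using R_not_Nil [OF u'R] by (cases u') auto
        then have "last umin = hd u'" unfolding eq .
        then show False using cyclically_reduced_R [OF umin(1)] 2 by simp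
      qed
      ultimately show ?thesis by blast
    qed
    then obtain w where w: "w \<in> through E v (hd umin)" "w \<noteq> umin" by blast
    then have "rank w \<le> rank umin" "w \<in> R" using top circles_R by (auto simp: edge_tops_def through_def)
    then show False using umin w(2) inj_rank by (metis inj_onD order_antisym)
  qed
  then have umin_not_V: "(v, umin) \<notin> ?V" for v using vertex_tops_subset by blast
  have reach: "\<exists>b. rotate b u = umin" if "u \<in> R" for u using rotate_R_transitive that umin by blast
  \<comment> \<open>The first time at which the circle is not on top at its vertex; it exists
    because some rotation reaches \<open>umin\<close>.\<close>
  define d where "d q = (LEAST i. (step ^^ i) q \<notin> ?V)" for q
  have d: "(step ^^ d q) q \<notin> ?V" "\<And>i. i < d q \<Longrightarrow> (step ^^ i) q \<in> ?V" if q: "q \<in> circles E" for q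
  proof -
    obtain b where "rotate b (snd q) = umin" using reach [OF circles_R [OF q]] by blast
    then have "(step ^^ b) q \<notin> ?V" using umin_not_V snd_funpow_step by (metis surjective_pairing)
    then show "(step ^^ d q) q \<notin> ?V" unfolding d_def by (rule LeastI)
    show "\<And>i. i < d q \<Longrightarrow> (step ^^ i) q \<in> ?V" unfolding d_def using not_less_Least by blast
  qed
  \<comment> \<open>The exit point is reached from a top of an edge without being a top of its
    vertex. Such points can therefore be added to \<open>?V\<close> within the image of
    \<open>edge_tops E\<close> under \<open>step\<close>.\<close>
  define \<phi> where "\<phi> q = (step ^^ d q) q" for q
  have \<phi>_in: "\<phi> q \<in> step ` edge_tops E - ?V" if q: "q \<in> lifts E" for q
  proof -
    have c: "q \<in> circles E" "q \<in> ?V" using q lifts_subset by (auto simp: lifts_def)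
    then have "d q \<noteq> 0" using d(1) [of q] by (metis funpow_0)
    then obtain i where i: "d q = Suc i" by (cases "d q") auto
    then have "(step ^^ i) q \<in> edge_tops E" using d(2) [OF c(1)] vertex_tops_subset by auto
    then show ?thesis using d(1) [OF c(1)] i by (auto simp: \<phi>_def)
  qed
  have step_inj: "q = q'" if "(step ^^ i) q = (step ^^ i) q'" "q \<in> circles E" "q' \<in> circles E" for i q q'
    using that
  proof (induction i)
    case (Suc i)
    have "unstep (step ((step ^^ i) q)) = unstep (step ((step ^^ i) q'))" using Suc.prems(1) by simp
    then show ?case
      using Suc unfolding unstep_step [OF funpow_step_circles [OF Suc.prems(2)]]
        unstep_step [OF funpow_step_circles [OF Suc.prems(3)]] by simp
  qed simp
  have \<phi>_inj: "inj_on \<phi> (lifts E)"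
  proof -
    have *: "q = q'" if q: "q \<in> lifts E" "q' \<in> lifts E" "\<phi> q = \<phi> q'" "d q \<le> d q'" for q q'
    proof -
      have c: "q \<in> circles E" "q' \<in> circles E" "snd q = umax" "snd q' = umax"
        using q by (auto simp: lifts_def)
      define e where "e = d q' - d q"
      have "(step ^^ d q) q = (step ^^ d q) ((step ^^ e) q')"
        using q(3,4) by (simp add: \<phi>_def e_def flip: funpow_add [THEN fun_cong, unfolded comp_def])
      then have qe: "q = (step ^^ e) q'" using step_inj c funpow_step_circles by blast
      have "e = 0"
      proof (rule ccontr)
        assume "e \<noteq> 0"
        \<comment> \<open>Two lifts with the same exit point lie on one orbit, \<open>e\<close>
          steps apart. Both read \<open>umax\<close>, so the rotations repeat with period
          \<open>e\<close>, and \<open>umin\<close> turns up before step \<open>e\<close>, hence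
          before the exit time of \<open>q'\<close>.\<close>
        have rot: "rotate e umax = umax" using qe c snd_funpow_step by metis
        obtain b where "rotate b umax = umin" using reach umax by blast
        moreover have "rotate (b mod e) umax = rotate b umax"
          using funpow_mod_eq [of e rotate1 umax b] rot by (simp add: rotate_def)
        ultimately have "(step ^^ (b mod e)) q' \<notin> ?V"
          using umin_not_V snd_funpow_step c by (metis surjective_pairing)
        moreover have "b mod e < d q'" using \<open>e \<noteq> 0\<close> by (metis e_def diff_le_self gr0I less_le_trans mod_less_divisor)
        ultimately show False using d(2) [OF c(2)] by blast
      qed
      then show ?thesis using qe by simp
    qed
    show ?thesis
    proof (rule inj_onI)
      fix q q' assume "q \<in> lifts E" "q' \<in> lifts E" "\<phi> q = \<phi> q'"
      then show "q = q'" using * [of q q'] * [of q' q] by (cases "d q \<le> d q'") auto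
    qed
  qed
  have ft: "finite (edge_tops E)" by (rule finite_subset [OF _ fc]) (auto simp: edge_tops_def)
  have fv: "finite ?V" using finite_subset [OF vertex_tops_subset ft] .
  have "fst ` circles E \<subseteq> fst ` ?V"
  proof
    fix v assume "v \<in> fst ` circles E"
    then obtain u where u: "(v, u) \<in> circles E" by auto
    let ?S = "{u. (v, u) \<in> circles E}"
    have "?S \<subseteq> R" using circles_R by fastforce
    then have fS: "finite (rank ` ?S)" using finite_subset finite_R by blast
    then have "Max (rank ` ?S) \<in> rank ` ?S" using u by (intro Max_in) auto
    then obtain t where t: "Max (rank ` ?S) = rank t" "t \<in> ?S" by (rule imageE)
    have "rank u' \<le> rank t" if "u' \<in> ?S" for u'
      unfolding t(1) [symmetric] using fS that by (intro Max_ge) auto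
    with t(2) have "(v, t) \<in> ?V" by (auto simp: vertex_tops_def)
    then show "v \<in> fst ` ?V" by force
  qed
  then have "card (fst ` circles E) \<le> card ?V"
    using surj_card_le [OF fv, of "fst ` circles E" fst] by blast
  moreover have "card (lifts E) = card (\<phi> ` lifts E)" using card_image [OF \<phi>_inj] by simp
  moreover have "card ?V + card (\<phi> ` lifts E) \<le> card (step ` edge_tops E)"
  proof -
    have "finite (\<phi> ` lifts E)" using fc by (auto simp: lifts_def)
    then have "card ?V + card (\<phi> ` lifts E) = card (?V \<union> \<phi> ` lifts E)"
      using fv \<phi>_in by (intro card_Un_disjoint [symmetric]) auto
    also have "\<dots> \<le> card (step ` edge_tops E)"
      using vertex_tops_arrive \<phi>_in ft by (intro card_mono) auto
    finally show ?thesis .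
  qed
  moreover have "card (step ` edge_tops E) \<le> card (edge_tops E)" using ft by (rule card_image_le)
  moreover have "card (edge_tops E) \<le> card E"
    using fin step_edge_in by (intro card_inj_on_le [OF inj_on_step_edge]) (auto simp: edge_tops_def)
  ultimately show ?thesis by linarith
qed

end

section \<open>Counting cochains modulo m\<close>

context relator_action
begin

definition cocycle :: "int \<Rightarrow> ('v \<times> 'x) set \<Rightarrow> ('v \<times> 'x \<Rightarrow> int) \<Rightarrow> bool" where
  "cocycle m E f \<longleftrightarrow> (\<forall>q \<in> circles E. m dvd fsum f (fst q) (snd q))"

definition coboundary :: "int \<Rightarrow> ('v \<times> 'x) set \<Rightarrow> ('v \<times> 'x \<Rightarrow> int) \<Rightarrow> bool" where
  "coboundary m E f \<longleftrightarrow> (\<exists>p. \<forall>(v, x) \<in> E. m dvd f (v, x) - (p (act v (x, True)) - p v))"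

lemma cocycle_if_lifts:
  assumes "\<And>q. q \<in> lifts E \<Longrightarrow> m dvd fsum f (fst q) (snd q)"
  shows "cocycle m E f"
  unfolding cocycle_def
proof
  fix q assume q: "q \<in> circles E"
  obtain i where "rotate i (snd q) = umax" using rotate_R_transitive circles_R [OF q] umax by blast
  then have "(step ^^ i) q \<in> lifts E" using q funpow_step_circles snd_funpow_step by (auto simp: lifts_def)
  then show "m dvd fsum f (fst q) (snd q)" using assms fsum_funpow_step [OF q] by metis
qed

text \<open>A cochain is determined modulo \<open>m\<close> by its values on the lifts of one fixed
  relator, up to a coboundary; and a coboundary is determined by a potential that vanishes at
  one vertex.\<close>

lemma card_edges_less:
  fixes m :: nat
  assumes fin: "finite E" and "E \<noteq> {}" and m: "2 \<le> m"
    and covered: "\<And>e. e \<in> E \<Longrightarrow> \<exists>q \<in> circles E. step_edge q = e"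
    and cob: "\<And>f. cocycle (int m) E f \<Longrightarrow> coboundary (int m) E f"
  shows "card E < card (fst ` circles E) + card (lifts E)"
proof -
  let ?V = "fst ` circles E" and ?M = "{0..<int m}"
  have fc: "finite (circles E)" using finite_circles fin .
  have fl: "finite (lifts E)" using fc by (auto simp: lifts_def)
  obtain v0 where v0: "v0 \<in> ?V" using covered \<open>E \<noteq> {}\<close> by blast
  have ends: "w \<in> ?V" "act w (x, True) \<in> ?V" if e: "(w, x) \<in> E" for w x
  proof -
    obtain q where q: "q \<in> circles E" "step_edge q = (w, x)" using covered e by blast
    then have "edge (fst q) (hd (snd q)) = edge w (x, True)" by (simp add: step_edge_def edge_def)
    moreover have V: "fst q \<in> ?V" "act (fst q) (hd (snd q)) \<in> ?V"
      using imageI [OF q(1), of fst] imageI [OF step_circles [OF q(1)], of fst]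
      by (simp_all add: step_def)
    ultimately have "w \<in> ?V \<and> act w (x, True) \<in> ?V"
    proof (cases rule: edge_eq_cases)
      case 1
      then show ?thesis using V by simp
    next
      case 2
      have "act w (x, True) = fst q" unfolding 2 by simp
      then show ?thesis using V 2(1) by simp
    qed
    then show "w \<in> ?V" "act w (x, True) \<in> ?V" by auto
  qed
  define A where "A = (E \<rightarrow>\<^sub>E ?M)"
  define \<Phi> where "\<Phi> f = (\<lambda>q \<in> lifts E. fsum f (fst q) (snd q) mod int m)" for f
  \<comment> \<open>\<open>sec f\<close> depends only on \<open>\<Phi> f\<close>, so the difference
    of \<open>f\<close> and \<open>sec f\<close> vanishes modulo \<open>m\<close> on the lifts. It
    is then a cocycle, hence the coboundary of some \<open>p f\<close>, and \<open>f\<close> is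
    recovered from \<open>\<Phi> f\<close> and \<open>p f\<close>.\<close>
  define sec where "sec f = (SOME g. g \<in> A \<and> \<Phi> g = \<Phi> f)" for f
  have sec: "sec f \<in> A \<and> \<Phi> (sec f) = \<Phi> f" if "f \<in> A" for f
    unfolding sec_def by (rule someI [of _ f]) (simp add: that)
  have sec_cong: "sec f = sec g" if "\<Phi> f = \<Phi> g" for f g
    unfolding sec_def that ..
  have "\<exists>p. \<forall>(w, x) \<in> E. int m dvd (f (w, x) - sec f (w, x)) - (p (act w (x, True)) - p w)" if f: "f \<in> A" for f
  proof -
    have "cocycle (int m) E (\<lambda>e. f e - sec f e)"
    proof (rule cocycle_if_lifts)
      fix q assume q: "q \<in> lifts E"
      have "\<Phi> (sec f) q = \<Phi> f q" using sec [OF f] by simp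
      then have "fsum (sec f) (fst q) (snd q) mod int m = fsum f (fst q) (snd q) mod int m"
        using q by (simp add: \<Phi>_def)
      then show "int m dvd fsum (\<lambda>e. f e - sec f e) (fst q) (snd q)"
        by (simp add: fsum_diff mod_eq_dvd_iff [symmetric])
    qed
    then show ?thesis using cob by (auto simp: coboundary_def)
  qed
  then obtain p where p: "\<And>f w x. f \<in> A \<Longrightarrow> (w, x) \<in> E \<Longrightarrow>
      int m dvd (f (w, x) - sec f (w, x)) - (p f (act w (x, True)) - p f w)"
    by (metis (no_types, lifting) case_prodD)
  \<comment> \<open>Only differences of the potential matter, so \<open>v0\<close> gets no entry;
    this missing entry makes the final inequality strict.\<close>
  define \<Psi> where "\<Psi> f = (\<Phi> f, \<lambda>v \<in> ?V - {v0}. (p f v - p f v0) mod int m)" for f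
  have "inj_on \<Psi> A"
  proof (rule inj_onI)
    fix f g assume f: "f \<in> A" and g: "g \<in> A" and eq: "\<Psi> f = \<Psi> g"
    have s: "sec f = sec g" using eq by (intro sec_cong) (simp add: \<Psi>_def)
    have pm: "int m dvd (p f v - p f v0) - (p g v - p g v0)" if "v \<in> ?V" for v
    proof (cases "v = v0")
      case False
      have "snd (\<Psi> f) v = snd (\<Psi> g) v" using eq by simp
      then have "(p f v - p f v0) mod int m = (p g v - p g v0) mod int m"
        using False that by (simp add: \<Psi>_def)
      then show ?thesis by (simp add: mod_eq_dvd_iff)
    qed simp
    show "f = g"
    proof (rule PiE_ext [of f E "\<lambda>_. ?M" g])
      fix e assume e: "e \<in> E"
      obtain w x where wx: "e = (w, x)" by (cases e)
      let ?w = "act w (x, True)"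
      have E: "(w, x) \<in> E" using e wx by simp
      have "int m dvd (f e - sec f e - (p f ?w - p f w)) - (g e - sec g e - (p g ?w - p g w))
          + ((p f ?w - p f v0) - (p g ?w - p g v0)) - ((p f w - p f v0) - (p g w - p g v0))"
        unfolding wx
        by (rule dvd_diff [OF dvd_add [OF dvd_diff [OF p [OF f E] p [OF g E]] pm [OF ends(2) [OF E]]]
              pm [OF ends(1) [OF E]]])
      then have "int m dvd f e - g e" by (simp add: s algebra_simps)
      then have "f e mod int m = g e mod int m" by (simp add: mod_eq_dvd_iff)
      moreover have "f e \<in> ?M" "g e \<in> ?M" using f g e by (auto simp: A_def PiE_iff)
      ultimately show "f e = g e" by simp
    qed (use f g in \<open>auto simp: A_def\<close>)
  qed
  moreover have "\<Psi> ` A \<subseteq> (lifts E \<rightarrow>\<^sub>E ?M) \<times> (?V - {v0} \<rightarrow>\<^sub>E ?M)"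
    using m unfolding \<Psi>_def \<Phi>_def
    by (intro image_subsetI SigmaI) (simp_all only: restrict_PiE_iff, simp_all)
  moreover have "finite ((lifts E \<rightarrow>\<^sub>E ?M) \<times> (?V - {v0} \<rightarrow>\<^sub>E ?M))"
    using fl fc by (intro finite_cartesian_product finite_PiE) auto
  ultimately have "card A \<le> card ((lifts E \<rightarrow>\<^sub>E ?M) \<times> (?V - {v0} \<rightarrow>\<^sub>E ?M))"
    by (rule card_inj_on_le)
  then have "m ^ card E \<le> m ^ card (lifts E) * m ^ card (?V - {v0})"
    using fin fl fc by (simp add: A_def card_PiE card_cartesian_product)
  then have "card E \<le> card (lifts E) + card (?V - {v0})"
    using m by (simp add: power_add [symmetric])
  moreover have "0 < card ?V" using v0 fc by (auto simp: card_gt_0_iff)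
  ultimately show ?thesis using v0 fc by (simp add: card_Diff_singleton)
qed

lemma coboundary_walk:
  assumes "coboundary m E f"
  obtains p where "\<And>v l. edge v l \<in> E \<Longrightarrow> m dvd val f v l - (p (act v l) - p v)"
    "\<And>v u. trav v u \<subseteq> E \<Longrightarrow> m dvd fsum f v u - (p (acts v u) - p v)"
proof -
  obtain p where p: "\<And>w x. (w, x) \<in> E \<Longrightarrow> m dvd f (w, x) - (p (act w (x, True)) - p w)"
    using assms by (auto simp: coboundary_def)
  show ?thesis using that [of p] val_coboundary [OF p] fsum_coboundary [OF p] by blast
qed

lemma coboundary_mono: "coboundary m E f \<Longrightarrow> E' \<subseteq> E \<Longrightarrow> coboundary m E' f"
  unfolding coboundary_def by blast

lemma coboundary_cong:
  assumes "coboundary m E f" "\<And>e. e \<in> E \<Longrightarrow> f e = g e"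
  shows "coboundary m E g"
  using assms unfolding coboundary_def by fastforce

text \<open>An edge on no circle is a bridge, so one side of it can be translated.\<close>

lemma potential_bridge:
  assumes G: "group G" and \<theta>: "\<And>x. \<theta> x \<in> carrier G" and m: "2 \<le> m"
    and P: "\<And>v. P v \<in> carrier G"
      "\<And>v x. (v, x) \<in> E - {(s, y)} \<Longrightarrow> P (act v (x, True)) = P v \<otimes>\<^bsub>G\<^esub> \<theta> x"
    and cob: "coboundary m E ((\<lambda>_. 0)((s, y) := 1))" and e: "(s, y) \<in> E"
  shows "\<exists>P. (\<forall>v. P v \<in> carrier G) \<and> (\<forall>(v, x) \<in> E. P (act v (x, True)) = P v \<otimes>\<^bsub>G\<^esub> \<theta> x)"
proof -
  interpret group G by fact
  obtain p where p: "\<And>v x. (v, x) \<in> E \<Longrightarrow>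
      m dvd ((\<lambda>_. 0)((s, y) := 1)) (v, x) - (p (act v (x, True)) - p v)"
    using cob by (auto simp: coboundary_def)
  let ?t = "act s (y, True)"
  \<comment> \<open>The potential of the indicator cochain is constant modulo \<open>m\<close> along
    every other edge of \<open>E\<close> and jumps by 1 along this one. So \<open>S\<close> contains
    the end point but not the start, and no other edge of \<open>E\<close> leaves it.\<close>
  define S where "S = {v. m dvd p v - p ?t}"
  have "s \<notin> S"
  proof
    assume "s \<in> S"
    then have "m dvd p s - p ?t" by (simp add: S_def)
    moreover have "m dvd 1 - (p ?t - p s)" using p [OF e] by simp
    ultimately have "m dvd (1 - (p ?t - p s)) - (p s - p ?t)" by (rule dvd_diff [rotated])
    then have "m dvd 1" by simp
    then show False using m zdvd_imp_le [of m 1] by simp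
  qed
  have "?t \<in> S" by (simp add: S_def)
  have S: "act v (x, True) \<in> S \<longleftrightarrow> v \<in> S" if "(v, x) \<in> E - {(s, y)}" for v x
  proof -
    have "((\<lambda>_. 0)((s, y) := 1)) (v, x) = (0::int)" using that by auto
    then have "m dvd p v - p (act v (x, True))" using p [of v x] that by (simp add: dvd_diff_commute)
    then have "m dvd p (act v (x, True)) - p ?t \<longleftrightarrow> m dvd p v - p ?t"
      using dvd_add_right_iff [of m "p v - p (act v (x, True))" "p (act v (x, True)) - p ?t"]
      by simp
    then show ?thesis by (simp add: S_def)
  qed
  define c where "c = P s \<otimes>\<^bsub>G\<^esub> \<theta> y \<otimes>\<^bsub>G\<^esub> inv\<^bsub>G\<^esub> P ?t"
  have c: "c \<in> carrier G" using P \<theta> by (simp add: c_def)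
  define Q where "Q v = (if v \<in> S then c \<otimes>\<^bsub>G\<^esub> P v else P v)" for v
  have "Q (act v (x, True)) = Q v \<otimes>\<^bsub>G\<^esub> \<theta> x" if E: "(v, x) \<in> E" for v x
  proof (cases "(v, x) = (s, y)")
    case True
    then show ?thesis using \<open>s \<notin> S\<close> \<open>?t \<in> S\<close> P \<theta> by (simp add: Q_def c_def m_assoc)
  next
    case False
    then have "(v, x) \<in> E - {(s, y)}" using E by simp
    then show ?thesis using S [of v x] P(2) [of v x] c P(1) \<theta> by (simp add: Q_def m_assoc)
  qed
  moreover have "Q v \<in> carrier G" for v using c P by (simp add: Q_def)
  ultimately show ?thesis by blast
qed

lemma fsum_periodic:
  assumes q: "q \<in> circles E" and a: "(step ^^ a) q = q" "a dvd N"
  shows "fsum f (fst q) (snd q) = int (N div a) * fsum f (fst q) (take a (snd q))"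
proof -
  let ?g = "\<lambda>i. val f (fst ((step ^^ i) q)) (hd (snd ((step ^^ i) q)))"
  have len: "length (snd q) = N" using length_R circles_R q by blast
  have per: "?g (k * a + i) = ?g i" for k i
  proof -
    have "(step ^^ (i + k * a)) q = (step ^^ i) q"
    proof (induction k)
      case (Suc k)
      have "i + Suc k * a = (i + k * a) + a" by simp
      then show ?case using Suc a(1) by (simp only: funpow_add comp_apply)
    qed simp
    then show ?thesis by (simp add: add.commute)
  qed
  have sum: "(\<Sum>i<k * a. ?g i) = int k * (\<Sum>i<a. ?g i)" for k
  proof (induction k)
    case (Suc k)
    have "(\<Sum>i<Suc k * a. ?g i) = (\<Sum>i<k * a. ?g i) + (\<Sum>i<a. ?g (k * a + i))"
      using sum.nat_group [of ?g a 1] sum.atLeastLessThan_concat [of 0 "k * a" "k * a + a" ?g]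
        sum.shift_bounds_nat_ivl [of ?g 0 "k * a" a]
      by (simp add: atLeast0LessThan add.commute)
    then show ?case using Suc by (simp only: per) (simp add: algebra_simps)
  qed simp
  have "fsum f (fst q) (take N (snd q)) = (\<Sum>i<N. ?g i)"
    using fsum_conv_sum [of N "snd q" f "fst q"] len by simp
  moreover have "fsum f (fst q) (take a (snd q)) = (\<Sum>i<a. ?g i)"
    using fsum_conv_sum [of a "snd q" f "fst q"] len dvd_imp_le [OF a(2) N_pos] by simp
  moreover have "N = (N div a) * a" using a(2) by simp
  ultimately show ?thesis using sum [of "N div a"] len by simp
qed

text \<open>An edge crossed by a single marked circle can be collapsed together with that circle.
  The period of the circle under \<open>step\<close> is \<open>N\<close>: otherwise a cochain supported
  on the edge would be a cocycle with values in the integers modulo \<open>2 N\<close>, although it does not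
  vanish on the underlying simple circle.\<close>

lemma collapse_free_edge:
  assumes q: "q \<in> circles E" and e: "step_edge q = e"
    and uniq: "\<And>q'. q' \<in> circles E \<Longrightarrow> step_edge q' = e \<Longrightarrow> q' = q"
    and cob: "\<And>f. cocycle (2 * int N) E f \<Longrightarrow> coboundary (2 * int N) E f"
  shows "e \<notin> trav (act (fst q) (hd (snd q))) (tl (snd q))"
    and "cocycle (2 * int N) (E - {e}) f \<Longrightarrow> coboundary (2 * int N) (E - {e}) f"
proof -
  let ?m = "2 * int N"
  obtain v l u where q': "q = (v, l # u)"
    using q R_not_Nil by (metis circles_R list.exhaust surjective_pairing)
  have len: "length (l # u) = N" using length_R [OF circles_R [OF q]] q' by simp
  define a where "a = (LEAST i. 0 < i \<and> (step ^^ i) q = q)"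
  have "0 < a \<and> (step ^^ a) q = q"
    unfolding a_def by (rule LeastI [of _ N]) (use N_pos funpow_step_N [OF q] in simp)
  then have a: "0 < a" "(step ^^ a) q = q" by auto
  have a_least: "(step ^^ i) q \<noteq> q" if "0 < i" "i < a" for i
    using not_less_Least [of i "\<lambda>i. 0 < i \<and> (step ^^ i) q = q"] that by (auto simp: a_def)
  have "(step ^^ (N mod a)) q = q" using funpow_mod_eq [OF a(2)] funpow_step_N [OF q] by simp
  then have "N mod a = 0" using a_least [of "N mod a"] a(1) by fastforce
  then have dvd: "a dvd N" by blast
  then have aN: "a \<le> N" using N_pos by (rule dvd_imp_le)
  \<comment> \<open>Another crossing of the edge within one period, in either direction, would be a
    second marked circle with this \<open>step_edge\<close>.\<close>
  have free: "step_edge ((step ^^ i) q) \<noteq> e" if "0 < i" "i < a" for i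
    using uniq [OF funpow_step_circles [OF q]] a_least [OF that] by blast
  obtain b where b: "a = Suc b" using a(1) by (cases a) auto
  have take_a: "take a (l # u) = l # take b u" using b by simp
  have rest: "e \<notin> trav (act v l) (take b u)"
  proof -
    have "trav (act v l) (take b u) = (\<lambda>i. step_edge ((step ^^ i) (act v l, u @ [l]))) ` {..<b}"
      using trav_conv_image [of b "u @ [l]" "act v l"] len aN b by simp
    also have "(act v l, u @ [l]) = (step ^^ 1) q" using q' by (simp add: step_def)
    also have "(\<lambda>i. step_edge ((step ^^ i) ((step ^^ 1) q))) = (\<lambda>i. step_edge ((step ^^ Suc i) q))"
      by (simp add: funpow_swap1)
    finally show ?thesis using free b by (auto simp del: funpow.simps)
  qed
  have vale: "val (f(e := c)) v l = (if snd l then c else - c)" for f c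
    using e q' by (simp add: val_def step_edge_def)
  have upd: "fsum (f(e := c)) v (take a (l # u)) = (if snd l then c else - c) + fsum f (act v l) (take b u)" for f c
    unfolding take_a using rest by (simp add: vale) (auto intro!: fsum_cong)
  \<comment> \<open>The circles through \<open>e\<close> all lie in the orbit of \<open>q\<close>;
    they run \<open>N div a\<close> times round a path of length \<open>a\<close> that crosses
    \<open>e\<close> once.\<close>
  have extend: "cocycle ?m E (f(e := c))"
    if f: "cocycle ?m (E - {e}) f"
      and c: "?m dvd int (N div a) * ((if snd l then c else - c) + fsum f (act v l) (take b u))" for f c
    unfolding cocycle_def
  proof
    fix r assume r: "r \<in> circles E"
    show "?m dvd fsum (f(e := c)) (fst r) (snd r)"
    proof (cases "e \<in> trav (fst r) (snd r)")
      case True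
      then obtain i where "step_edge ((step ^^ i) r) = e" using trav_circle [OF r] by auto
      then have "(step ^^ i) r = q" using uniq funpow_step_circles [OF r] by blast
      then have "fsum (f(e := c)) (fst r) (snd r) = fsum (f(e := c)) (fst q) (snd q)"
        using fsum_funpow_step [OF r] by metis
      also have "\<dots> = int (N div a) * ((if snd l then c else - c) + fsum f (act v l) (take b u))"
        using fsum_periodic [OF q a(2) dvd, of "f(e := c)"] upd q' by simp
      finally show ?thesis using c by simp
    next
      case False
      then have "fsum (f(e := c)) (fst r) (snd r) = fsum f (fst r) (snd r)"
        by (intro fsum_cong) auto
      then show ?thesis using f r False by (auto simp: cocycle_def circles_Diff)
    qed
  qed
  have "a = N"
  proof -
    \<comment> \<open>The \<open>N div a\<close> laps turn \<open>2 * a\<close> into the modulus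
      \<open>2 * N\<close>, so this is a cocycle. Being a coboundary, it vanishes modulo
      \<open>2 * N\<close> on a single lap, which forces \<open>N dvd a\<close>.\<close>
    let ?f = "(\<lambda>_. 0)(e := 2 * int a)"
    have zero: "fsum (\<lambda>_. 0) w z = 0" for w z by (induction z arbitrary: w) (auto simp: val_def)
    have "int (N div a) * int a = int N" using dvd by (metis dvd_div_mult_self of_nat_mult)
    then have "cocycle ?m E ?f"
      by (intro extend) (auto simp: cocycle_def zero algebra_simps)
    then have "coboundary ?m E ?f" by (rule cob)
    then obtain p where p: "\<And>v u. trav v u \<subseteq> E \<Longrightarrow> ?m dvd fsum ?f v u - (p (acts v u) - p v)"
      by (rule coboundary_walk) blast
    have "trav v (l # u) \<subseteq> E" using q q' by (simp add: circles_def)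
    moreover have "trav v (take a (l # u)) \<subseteq> trav v (l # u)"
      using trav_append [of v "take a (l # u)" "drop a (l # u)"]
      unfolding append_take_drop_id by blast
    ultimately have "trav v (take a (l # u)) \<subseteq> E" by blast
    moreover have "acts v (take a (l # u)) = v"
      using a(2) funpow_step [of a "l # u" v] q' len aN by simp
    ultimately have "?m dvd (if snd l then 2 * int a else - (2 * int a))"
      using p [of v "take a (l # u)"] upd [of "\<lambda>_. 0" "2 * int a"] zero by simp
    then have "2 * int N dvd 2 * int a" by (simp split: if_splits)
    then have "N dvd a" by simp
    then show "a = N" using aN a(1) by (simp add: dvd_imp_le order_antisym)
  qed
  then have "take b u = u" using b len by simp
  then show "e \<notin> trav (act (fst q) (hd (snd q))) (tl (snd q))" using rest q' by simp
  show "coboundary ?m (E - {e}) f" if f: "cocycle ?m (E - {e}) f"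
  proof -
    \<comment> \<open>This value makes the sum over a lap zero, so the cocycle extends over the
      removed cell.\<close>
    define c where "c = (if snd l then - fsum f (act v l) (take b u) else fsum f (act v l) (take b u))"
    have "cocycle ?m E (f(e := c))" by (rule extend [OF f]) (simp add: c_def)
    then have "coboundary ?m E (f(e := c))" by (rule cob)
    then have "coboundary ?m (E - {e}) (f(e := c))" by (rule coboundary_mono) auto
    then show ?thesis by (rule coboundary_cong) auto
  qed
qed

theorem potential_exists:
  assumes G: "group G" and \<theta>: "\<And>x. \<theta> x \<in> carrier G"
    and relators: "\<And>u. u \<in> R \<Longrightarrow> word_eval G \<theta> u = \<one>\<^bsub>G\<^esub>"
    and "finite E" "\<And>f. cocycle (2 * int N) E f \<Longrightarrow> coboundary (2 * int N) E f"
  shows "\<exists>P. (\<forall>v. P v \<in> carrier G) \<and> (\<forall>(v, x) \<in> E. P (act v (x, True)) = P v \<otimes>\<^bsub>G\<^esub> \<theta> x)"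
  using assms(4,5)
proof (induction E rule: finite_psubset_induct)
  case (psubset E)
  interpret group G by fact
  let ?m = "2 * int N"
  note cob = psubset.prems
  show ?case
  proof (cases "E = {}")
    case True
    then show ?thesis by (intro exI [of _ "\<lambda>_. \<one>\<^bsub>G\<^esub>"]) simp
  next
    case nonempty: False
    \<comment> \<open>If every edge lies on a circle and none is crossed by only one marked circle,
      \<open>card_edges_less\<close> and \<open>Louder_Wilton\<close> contradict each other.\<close>
    have less: "circles E \<noteq> {} \<Longrightarrow> False"
      if "\<And>e. e \<in> E \<Longrightarrow> \<exists>q \<in> circles E. step_edge q = e"
        "\<And>q. q \<in> circles E \<Longrightarrow> \<exists>q' \<in> circles E. q' \<noteq> q \<and> step_edge q' = step_edge q"
      using card_edges_less [OF psubset.hyps(1) nonempty, of "2 * N"] that cob N_pos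
        Louder_Wilton [OF psubset.hyps(1) that(2)] by simp
    consider (bridge) e where "e \<in> E" "\<And>q. q \<in> circles E \<Longrightarrow> step_edge q \<noteq> e"
      | (collapse) q where "q \<in> circles E"
        "\<And>q'. q' \<in> circles E \<Longrightarrow> step_edge q' = step_edge q \<Longrightarrow> q' = q"
      using less nonempty by blast
    then show ?thesis
    proof cases
      case bridge
      obtain s y where e: "e = (s, y)" by (cases e)
      have avoid: "e \<notin> trav (fst q) (snd q)" if "q \<in> circles E" for q
        unfolding trav_circle [OF that] using bridge(2) funpow_step_circles [OF that] by blast
      have "coboundary ?m (E - {e}) f" if f: "cocycle ?m (E - {e}) f" for f
      proof -
        have "cocycle ?m E f" using f avoid by (auto simp: cocycle_def circles_Diff)
        then show ?thesis using cob coboundary_mono by blast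
      qed
      then obtain P where P: "\<And>v. P v \<in> carrier G"
        "\<And>v x. (v, x) \<in> E - {(s, y)} \<Longrightarrow> P (act v (x, True)) = P v \<otimes>\<^bsub>G\<^esub> \<theta> x"
        using psubset.IH [of "E - {e}"] bridge(1) e by blast
      have "cocycle ?m E ((\<lambda>_. 0)((s, y) := 1))"
        unfolding cocycle_def
      proof
        fix q assume q: "q \<in> circles E"
        have "fsum ((\<lambda>_. 0)((s, y) := 1)) (fst q) (snd q) = fsum (\<lambda>_. 0) (fst q) (snd q)"
          using avoid [OF q] e by (intro fsum_cong) auto
        also have "\<dots> = fsum (\<lambda>e. 0 - 0) (fst q) (snd q)" by simp
        also have "\<dots> = 0" unfolding fsum_diff by simp
        finally show "?m dvd fsum ((\<lambda>_. 0)((s, y) := 1)) (fst q) (snd q)" by simp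
      qed
      then have "coboundary ?m E ((\<lambda>_. 0)((s, y) := 1))" by (rule cob)
      moreover have "2 \<le> ?m" using N_pos by simp
      moreover have "(s, y) \<in> E" using bridge(1) e by simp
      ultimately show ?thesis using potential_bridge [OF G \<theta> _ P] by blast
    next
      case collapse
      let ?e = "step_edge q"
      obtain v l u where q': "q = (v, l # u)"
        using collapse(1) R_not_Nil by (metis circles_R list.exhaust surjective_pairing)
      have e: "?e = edge v l" using q' by (simp add: step_edge_def)
      have "?e \<in> E" using step_edge_in collapse(1) .
      note col = collapse_free_edge [OF collapse(1) refl collapse(2) cob]
      obtain P where P: "\<And>v. P v \<in> carrier G"
        "\<And>v x. (v, x) \<in> E - {?e} \<Longrightarrow> P (act v (x, True)) = P v \<otimes>\<^bsub>G\<^esub> \<theta> x"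
        using psubset.IH [of "E - {?e}"] \<open>?e \<in> E\<close> col(2) by blast
      have "trav v (l # u) \<subseteq> E" "acts v (l # u) = v" "l # u \<in> R"
        using collapse(1) q' by (auto simp: circles_def)
      moreover have "?e \<notin> trav (act v l) u" using col(1) q' by simp
      \<comment> \<open>The rest of the circle avoids the removed edge, so \<open>P\<close>
        multiplies along it; since the relator has value 1, this forces the equation on the edge
        itself.\<close>
      ultimately have "P v = P (act v l) \<otimes>\<^bsub>G\<^esub> word_eval G \<theta> u"
        using word_eval_potential [where P = P and E = "E - {?e}" and v = "act v l" and u = u, OF G \<theta> P] by auto
      moreover have "word_eval G \<theta> u = inv\<^bsub>G\<^esub> (if snd l then \<theta> (fst l) else inv\<^bsub>G\<^esub> \<theta> (fst l))"
        (is "_ = inv\<^bsub>G\<^esub> ?g")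
      proof -
        have closed: "?g \<in> carrier G" "word_eval G \<theta> u \<in> carrier G" using \<theta> by simp_all
        have "?g \<otimes>\<^bsub>G\<^esub> word_eval G \<theta> u = \<one>\<^bsub>G\<^esub>" using relators [OF \<open>l # u \<in> R\<close>] by simp
        then show ?thesis using inv_equality [OF inv_comm [OF _ closed]] closed by simp
      qed
      ultimately have Pl: "P v = P (act v l) \<otimes>\<^bsub>G\<^esub> inv\<^bsub>G\<^esub> (if snd l then \<theta> (fst l) else inv\<^bsub>G\<^esub> \<theta> (fst l))"
        by simp
      have "P (act w (x, True)) = P w \<otimes>\<^bsub>G\<^esub> \<theta> x" if wx: "(w, x) \<in> E" for w x
      proof (cases "(w, x) = ?e")
        case True
        show ?thesis
        proof (cases "snd l")
          case True
          then have "w = v" "l = (x, True)" using \<open>(w, x) = ?e\<close> e by (auto simp: edge_def prod_eq_iff)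
          then show ?thesis using Pl P(1) \<theta> by (simp add: m_assoc)
        next
          case False
          have w: "w = act v l" "(x, True) = letter_inv l"
            using False \<open>(w, x) = ?e\<close> e by (auto simp: edge_def letter_inv_def prod_eq_iff)
          have "act w (x, True) = v" unfolding w by simp
          moreover have "fst l = x" using w(2) by (simp add: letter_inv_def)
          ultimately have wv: "act w (x, True) = v" "fst l = x" by simp_all
          show ?thesis using Pl False \<theta> unfolding wv(1) by (simp add: wv(2) w(1))
        qed
      qed (use P(2) wx in auto)
      then show ?thesis using P(1) by blast
    qed
  qed
qed

end

subsection \<open>The rotations of a cyclically reduced word\<close>

definition cyclically_reduced :: "'x letter list \<Rightarrow> bool" where
  "cyclically_reduced u \<longleftrightarrow> u \<noteq> [] \<and> reduced u \<and> hd u \<noteq> letter_inv (last u)"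

lemma cyclically_reduced_rotate1:
  assumes "cyclically_reduced u"
  shows "cyclically_reduced (rotate1 u)"
proof -
  obtain l w where u: "u = l # w" using assms by (cases u) (auto simp: cyclically_reduced_def)
  show ?thesis
  proof (cases w rule: rev_cases)
    case Nil
    then show ?thesis using assms u by simp
  next
    case (snoc w' k)
    have "l \<noteq> letter_inv k" using assms u snoc by (auto simp: cyclically_reduced_def)
    moreover have "reduced w" "hd w \<noteq> letter_inv l"
      using assms u snoc by (auto simp: cyclically_reduced_def reduced_Cons)
    ultimately show ?thesis using u snoc
      by (cases w') (auto simp: cyclically_reduced_def reduced_def successively_append_iff successively_Cons hd_append)
  qed
qed

lemma cyclically_reduced_rotate: "cyclically_reduced u \<Longrightarrow> cyclically_reduced (rotate i u)"
  by (induction i) (auto simp: cyclically_reduced_rotate1)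

definition rotations :: "'x letter list \<Rightarrow> 'x letter list set" where
  "rotations r = range (\<lambda>i. rotate i r)"

definition magnus_rank :: "'x::linorder letter list set \<Rightarrow> 'x letter list \<Rightarrow> nat" where
  "magnus_rank R u = card {w \<in> R. magnus_less (magnus w) (magnus u)}"

lemma magnus_rank_less:
  fixes R :: "'x::wellorder letter list set"
  assumes "finite R" and red: "\<And>u. u \<in> R \<Longrightarrow> reduced u" and u: "u \<in> R" "v \<in> R"
  shows "magnus_rank R u < magnus_rank R v \<longleftrightarrow> magnus_less (magnus u) (magnus v)"
proof -
  have *: "magnus_rank R u < magnus_rank R v"
    if "u \<in> R" "v \<in> R" "magnus_less (magnus u) (magnus v)" for u v
    unfolding magnus_rank_def
  proof (rule psubset_card_mono)
    show "{w \<in> R. magnus_less (magnus w) (magnus u)} \<subset> {w \<in> R. magnus_less (magnus w) (magnus v)}"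
      using that magnus_less_trans magnus_less_irrefl by blast
  qed (use assms(1) in simp)
  show ?thesis
  proof
    assume less: "magnus_rank R u < magnus_rank R v"
    then have "magnus u \<noteq> magnus v" by (auto simp: magnus_rank_def)
    then show "magnus_less (magnus u) (magnus v)"
      using magnus_less_total * [OF u(2,1)] less by (metis less_asym)
  qed (use * u in blast)
qed

lemma finite_rotations [simp]: "finite (rotations r)"
proof -
  have "rotations r \<subseteq> (\<lambda>i. rotate i r) ` {..length r}"
    unfolding rotations_def
  proof clarify
    fix i
    have "rotate i r = rotate (i mod length r) r" by (rule rotate_conv_mod)
    then show "rotate i r \<in> (\<lambda>i. rotate i r) ` {..length r}"
      by (cases "r = []") (auto intro!: image_eqI [of _ _ "i mod length r"] less_imp_le)
  qed
  then show ?thesis using finite_subset by blast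
qed

lemma magnus_letter_cancel [simp]:
  "magnus (letter_inv l # l # u) = magnus u" "magnus (l # letter_inv l # u) = magnus u"
  "magnus (u @ [l, letter_inv l]) = magnus u" "magnus (u @ [letter_inv l, l]) = magnus u"
  using magnus_snoc [of "u @ [l]" "letter_inv l"] magnus_snoc [of "u @ [letter_inv l]" l]
    magnus_snoc [of u] rmul_inv_letter_rmul rmul_rmul_inv_letter
  by simp_all

text \<open>Moving the mark past the first letter \<open>l\<close> turns \<open>l # a\<close> into
  \<open>a @ [l]\<close>, which is its conjugate by \<open>l\<close>. So the assumptions on
  \<open>rank\<close> express that the Magnus order is invariant under conjugation.\<close>

lemma relator_action_rotations:
  fixes r :: "'x::wellorder letter list"
  assumes r: "cyclically_reduced r" and act: "word_action act"
  shows "relator_action act (rotations r) (length r) (magnus_rank (rotations r))"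
proof -
  let ?R = "rotations r"
  have cr: "cyclically_reduced u" if "u \<in> ?R" for u
    using that r cyclically_reduced_rotate by (auto simp: rotations_def)
  have ne: "u \<noteq> []" and red: "reduced u" if "u \<in> ?R" for u
    using cr [OF that] by (auto simp: cyclically_reduced_def)
  have rank: "magnus_rank ?R u < magnus_rank ?R v \<longleftrightarrow> magnus_less (magnus u) (magnus v)"
    if "u \<in> ?R" "v \<in> ?R" for u v
    by (rule magnus_rank_less [OF finite_rotations]) (use that red in auto)
  have rot: "rotate i u \<in> ?R" if u: "u \<in> ?R" for i u
  proof -
    obtain j where "u = rotate j r" using u by (auto simp: rotations_def)
    then have "rotate i u = rotate (i + j) r" by (simp add: rotate_rotate)
    then show ?thesis by (simp add: rotations_def)
  qed
  have rot1: "rotate1 u \<in> ?R" if "u \<in> ?R" for u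
    using rot [OF that, of 1] by simp
  have len: "length u = length r" if "u \<in> ?R" for u
    using that by (auto simp: rotations_def)
  have unrot: "last u # butlast u \<in> ?R" if u: "u \<in> ?R" for u
  proof -
    define w where "w = rotate (length u - 1) u"
    have "rotate1 w = rotate (Suc (length u - 1)) u" by (simp add: w_def)
    then have w1: "rotate1 w = u" using ne [OF u] by simp
    have wR: "w \<in> ?R" using rot [OF u] by (simp add: w_def)
    obtain l z where "w = l # z" using ne [OF wR] by (cases w) auto
    then have "last u # butlast u = w" using w1 by auto
    then show ?thesis using wR by simp
  qed
  show ?thesis
    unfolding relator_action_def
  proof (intro conjI act, unfold_locales)
    fix u u' assume u: "u \<in> ?R" "u' \<in> ?R"
    obtain i j where ij: "u = rotate i r" "u' = rotate j r" using u by (auto simp: rotations_def)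
    \<comment> \<open>Rotating by \<open>i * (length r - 1)\<close> undoes a rotation by
      \<open>i\<close>.\<close>
    have eq: "j + i * (length r - 1) + i = j + i * length r"
      using r by (cases r) (auto simp: cyclically_reduced_def)
    have "rotate (j + i * (length r - 1)) u = rotate (j + i * length r) r"
      unfolding ij rotate_rotate eq ..
    also have "\<dots> = rotate j r" by (subst (1 2) rotate_conv_mod) simp
    finally show "\<exists>k. rotate k u = u'" using ij by blast
  next
    fix u u' assume u: "u \<in> ?R" "u' \<in> ?R" and h: "hd u = hd u'"
      and less: "magnus_rank ?R u < magnus_rank ?R u'"
    obtain l a b where ab: "u = l # a" "u' = l # b"
      using ne u h by (metis list.exhaust list.sel(1))
    have "magnus_less (magnus (letter_inv l # u @ [l])) (magnus (letter_inv l # u' @ [l]))"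
      using less rank u by (intro magnus_less_conjugate) simp
    then have "magnus_less (magnus (rotate1 u)) (magnus (rotate1 u'))" unfolding ab append_Cons magnus_letter_cancel by simp
    then show "magnus_rank ?R (rotate1 u) < magnus_rank ?R (rotate1 u')" using rank rot1 u by simp
  next
    fix u u' assume u: "u \<in> ?R" "u' \<in> ?R" and h: "last u = last u'"
      and less: "magnus_rank ?R u < magnus_rank ?R u'"
    obtain l a b where ab: "u = a @ [l]" "u' = b @ [l]"
      using ne u h by (metis append_butlast_last_id)
    have "magnus_less (magnus (letter_inv (letter_inv l) # u @ [letter_inv l]))
        (magnus (letter_inv (letter_inv l) # u' @ [letter_inv l]))"
      using less rank u by (intro magnus_less_conjugate) simp
    then have "magnus_less (magnus ((l # a) @ [l, letter_inv l])) (magnus ((l # b) @ [l, letter_inv l]))"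
      unfolding ab by simp
    then have "magnus_less (magnus (last u # butlast u)) (magnus (last u' # butlast u'))"
      unfolding magnus_letter_cancel by (simp add: ab)
    then show "magnus_rank ?R (last u # butlast u) < magnus_rank ?R (last u' # butlast u')"
      using rank unrot u by simp
  next
    fix u u' assume u: "u \<in> ?R" "u' \<in> ?R" and h: "hd u = letter_inv (last u')"
    obtain l a where a: "u = l # a" using ne u by (metis list.exhaust)
    obtain b where b: "u' = b @ [letter_inv l]"
      using ne u h a by (metis append_butlast_last_id letter_inv_letter_inv list.sel(1))
    have "magnus_less (magnus u) (magnus u') \<longleftrightarrow> magnus_less (magnus (rotate1 u)) (magnus (last u' # butlast u'))"
    proof
      assume "magnus_less (magnus u) (magnus u')"
      then have "magnus_less (magnus (letter_inv l # u @ [l])) (magnus (letter_inv l # u' @ [l]))"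
        by (rule magnus_less_conjugate)
      then have "magnus_less (magnus (letter_inv l # l # a @ [l])) (magnus ((letter_inv l # b) @ [letter_inv l, l]))"
        unfolding a b by simp
      then show "magnus_less (magnus (rotate1 u)) (magnus (last u' # butlast u'))"
        unfolding magnus_letter_cancel by (simp add: a b)
    next
      assume "magnus_less (magnus (rotate1 u)) (magnus (last u' # butlast u'))"
      then have "magnus_less (magnus (letter_inv (letter_inv l) # rotate1 u @ [letter_inv l]))
          (magnus (letter_inv (letter_inv l) # (last u' # butlast u') @ [letter_inv l]))"
        by (rule magnus_less_conjugate)
      then have "magnus_less (magnus ((l # a) @ [l, letter_inv l])) (magnus (l # letter_inv l # b @ [letter_inv l]))"
        unfolding a b by simp
      then show "magnus_less (magnus u) (magnus u')"
        unfolding magnus_letter_cancel by (simp add: a b)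
    qed
    then show "magnus_rank ?R u < magnus_rank ?R u' \<longleftrightarrow>
        magnus_rank ?R (rotate1 u) < magnus_rank ?R (last u' # butlast u')"
      using rank u rot1 unrot by simp
  next
    show "inj_on (magnus_rank ?R) ?R"
    proof (rule inj_onI)
      fix u u' assume u: "u \<in> ?R" "u' \<in> ?R" and eq: "magnus_rank ?R u = magnus_rank ?R u'"
      then have "magnus u = magnus u'" using rank u magnus_less_total by (metis less_irrefl)
      then show "u = u'" using magnus_inject red u by blast
    qed
  next
    show "0 < length r" using r by (simp add: cyclically_reduced_def)
    show "?R \<noteq> {}" by (auto simp: rotations_def)
  qed (use rot1 unrot len cr in \<open>auto simp: cyclically_reduced_def\<close>)
qed

subsection \<open>Products of words\<close>

text \<open>Formal products are kept as lists of factors, because an assignment of residues to the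
  factors has a sum over the list even if it does not extend to the group that they
  generate.\<close>

definition expand :: "('x letter list \<times> bool) list \<Rightarrow> 'x letter list" where
  "expand U = concat (map (\<lambda>(h, b). if b then h else winv h) U)"

definition exponent_sum :: "('x letter list \<Rightarrow> int) \<Rightarrow> ('x letter list \<times> bool) list \<Rightarrow> int" where
  "exponent_sum a U = (\<Sum>(h, b) \<leftarrow> U. if b then a h else - a h)"

definition expand_inv :: "('x letter list \<times> bool) list \<Rightarrow> ('x letter list \<times> bool) list" where
  "expand_inv U = rev (map (\<lambda>(h, b). (h, \<not> b)) U)"

definition conjugates :: "'x letter list \<Rightarrow> ('x letter list \<times> bool) list \<Rightarrow> ('x letter list \<times> bool) list" where
  "conjugates r gs = map (\<lambda>(g, b). (g @ r @ winv g, b)) gs"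

lemma expand_simps [simp]:
  "expand [] = []" "expand (U @ V) = expand U @ expand V"
  "expand ((h, b) # U) = (if b then h else winv h) @ expand U"
  by (simp_all add: expand_def)

lemma exponent_sum_simps [simp]:
  "exponent_sum a [] = 0" "exponent_sum a (U @ V) = exponent_sum a U + exponent_sum a V"
  "exponent_sum a ((h, b) # U) = (if b then a h else - a h) + exponent_sum a U"
  by (simp_all add: exponent_sum_def)

lemma expand_inv_simps [simp]:
  "expand_inv [] = []" "expand_inv ((h, b) # U) = expand_inv U @ [(h, \<not> b)]"
  "fst ` set (expand_inv U) = fst ` set U"
  by (simp_all add: expand_inv_def image_image case_prod_unfold)

lemma expand_expand_inv [simp]: "expand (expand_inv U) = winv (expand U)"
  by (induction U) auto

lemma exponent_sum_expand_inv [simp]: "exponent_sum a (expand_inv U) = - exponent_sum a U"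
  by (induction U) auto

context word_action
begin

lemma fsum_expand:
  assumes "\<And>h b. (h, b) \<in> set U \<Longrightarrow> acts v h = v"
  shows "acts v (expand U) = v \<and> fsum f v (expand U) = exponent_sum (fsum f v) U"
  using assms
proof (induction U)
  case (Cons k U)
  obtain h b where k: "k = (h, b)" by (cases k)
  have "acts v h = v" using Cons.prems [of h b] k by simp
  then have "acts v (winv h) = v" "fsum f v (winv h) = - fsum f v h"
    using acts_winv [of v h] fsum_winv [of f v h] by simp_all
  moreover have "acts v (expand U) = v \<and> fsum f v (expand U) = exponent_sum (fsum f v) U"
    using Cons by auto
  ultimately show ?case using k \<open>acts v h = v\<close> by simp
qed simp

lemma trav_reachable: "(w, x) \<in> trav v u \<Longrightarrow> \<exists>z. acts v z = w"
proof (induction u arbitrary: v)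
  case (Cons l u)
  show ?case
  proof (cases "(w, x) = edge v l")
    case True
    then have "acts v (if snd l then [] else [l]) = w" by (simp add: edge_def split: if_splits)
    then show ?thesis by blast
  next
    case False
    then obtain z where "acts (act v l) z = w" using Cons by auto
    then have "acts v (l # z) = w" by simp
    then show ?thesis by blast
  qed
qed simp

end

subsection \<open>Schreier graphs\<close>

abbreviation free_UNIV :: "'x letter list monoid" where
  "free_UNIV \<equiv> free_group UNIV"

text \<open>The action has to be defined on a whole type. Sets that do not consist of reduced words
  are fixed, which keeps the law for inverse letters.\<close>

definition schreier_act :: "'x letter list set \<Rightarrow> 'x letter \<Rightarrow> 'x letter list set" where
  "schreier_act v l = (if v \<subseteq> carrier free_UNIV then v #>\<^bsub>free_UNIV\<^esub> [l] else v)"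

lemma carrier_free_UNIV: "carrier free_UNIV = {w. reduced w}"
  and mult_free_group: "u \<otimes>\<^bsub>free_group X\<^esub> v = free_reduce (u @ v)"
  and one_free_group: "\<one>\<^bsub>free_group X\<^esub> = []"
  by (simp_all add: free_group_def)

lemma reduced_winv: "reduced u \<Longrightarrow> reduced (winv u)"
  unfolding winv_def by (rule reduced_inverse)

lemma inv_free_group:
  assumes "u \<in> carrier (free_group X)"
  shows "inv\<^bsub>free_group X\<^esub> u = winv u"
proof -
  interpret group "free_group X" by (rule group_free_group)
  have "winv u \<in> carrier (free_group X)"
    using assms reduced_winv by (auto simp: free_group_def winv_def)
  then show ?thesis using assms by (intro inv_equality) (auto simp: mult_free_group one_free_group)
qed

interpretation schreier: word_action schreier_act
proof
  fix v :: "'x letter list set" and l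
  interpret group "free_UNIV :: 'x letter list monoid" by (rule group_free_group)
  show "schreier_act (schreier_act v l) (letter_inv l) = v"
  proof (cases "v \<subseteq> carrier free_UNIV")
    case True
    have l: "[l] \<in> carrier free_UNIV" "[letter_inv l] \<in> carrier free_UNIV"
      by (simp_all add: carrier_free_UNIV reduced_Cons)
    have "[l] \<otimes>\<^bsub>free_UNIV\<^esub> [letter_inv l] = \<one>\<^bsub>free_UNIV\<^esub>"
      by (simp add: mult_free_group one_free_group free_reduce_def)
    then show ?thesis
      using True l r_coset_subset_G [OF True l(1)] coset_mult_assoc [OF True l]
      by (simp add: schreier_act_def coset_mult_one)
  qed (simp add: schreier_act_def)
qed

lemma schreier_acts:
  assumes "v \<subseteq> carrier free_UNIV"
  shows "schreier.acts v u = v #>\<^bsub>free_UNIV\<^esub> free_reduce u"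
  using assms
proof (induction u arbitrary: v)
  case Nil
  interpret group "free_UNIV :: 'a letter list monoid" by (rule group_free_group)
  show ?case using coset_mult_one Nil by (simp add: one_free_group)
next
  case (Cons l u)
  interpret group "free_UNIV :: 'a letter list monoid" by (rule group_free_group)
  have car: "[l] \<in> carrier free_UNIV" "free_reduce u \<in> carrier free_UNIV"
    by (simp_all add: carrier_free_UNIV reduced_Cons)
  have "free_reduce (l # u) = [l] \<otimes>\<^bsub>free_UNIV\<^esub> free_reduce u"
    using free_reduce_append_cong [of "[l]" "[l]" "free_reduce u" u] by (simp add: mult_free_group)
  moreover have "schreier_act v l = v #>\<^bsub>free_UNIV\<^esub> [l]"
    using Cons.prems by (simp add: schreier_act_def)
  ultimately show ?case
    using Cons.IH [OF r_coset_subset_G [OF Cons.prems car(1)]] coset_mult_assoc [OF Cons.prems car]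
    by simp
qed

lemma schreier_acts_eq_iff:
  assumes "subgroup K free_UNIV"
  shows "schreier.acts K u = K \<longleftrightarrow> free_reduce u \<in> K"
proof -
  interpret group "free_UNIV :: 'a letter list monoid" by (rule group_free_group)
  have "free_reduce u \<in> carrier free_UNIV" by (simp add: carrier_free_UNIV)
  then show ?thesis
    unfolding schreier_acts [OF subgroup.subset [OF assms]]
    using coset_join1 coset_join2 assms subgroup.subset [OF assms] by metis
qed

text \<open>On closed paths at the base vertex the sum is a homomorphism from \<open>K\<close> to
  the integers, so divisibility is inherited from the generators.\<close>

lemma schreier_fsum_dvd:
  assumes S: "\<And>s. s \<in> S \<Longrightarrow> m dvd schreier.fsum f K s"
    and K: "K = generate free_UNIV (free_reduce ` S)" and "schreier.acts K u = K"
  shows "m dvd schreier.fsum f K u"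
proof -
  interpret group "free_UNIV :: 'a letter list monoid" by (rule group_free_group)
  have sub: "subgroup K free_UNIV"
    unfolding K by (rule generate_is_subgroup) (auto simp: carrier_free_UNIV)
  have closed: "schreier.acts K h = K" if "h \<in> K" for h
    using that schreier_acts_eq_iff [OF sub] subgroup.mem_carrier [OF sub that]
    by (simp add: carrier_free_UNIV free_reduce_reduced)
  have "m dvd schreier.fsum f K h" if "h \<in> generate free_UNIV (free_reduce ` S)" for h
    using that
  proof (induction h rule: generate.induct)
    case one
    then show ?case by (simp add: one_free_group)
  next
    case (incl h)
    then show ?case using S by auto
  next
    case (inv h)
    then have "h \<in> K" using K generate.incl by metis
    then have "schreier.fsum f K (winv h) = - schreier.fsum f K h"
      using schreier.fsum_winv [of f K h] closed by simp
    moreover have "m dvd schreier.fsum f K h" using inv S by auto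
    ultimately show ?case
      using inv_free_group [of h UNIV] subgroup.mem_carrier [OF sub \<open>h \<in> K\<close>] by simp
  next
    case (eng h1 h2)
    then have "schreier.acts K h1 = K" using closed K by metis
    then show ?case using eng by (simp add: mult_free_group)
  qed
  moreover have "free_reduce u \<in> K" using assms(3) schreier_acts_eq_iff [OF sub] by simp
  ultimately show ?thesis using K by (metis schreier.fsum_free_reduce)
qed

text \<open>The potential at a vertex is the sum along a chosen path from the base vertex. The
  choice is immaterial modulo \<open>m\<close>, because closed paths have sums divisible by
  \<open>m\<close>.\<close>

lemma schreier_potential:
  assumes S: "\<And>s. s \<in> S \<Longrightarrow> m dvd schreier.fsum f K s"
    and K: "K = generate free_UNIV (free_reduce ` S)"
  shows "\<exists>p. \<forall>s \<in> S. \<forall>(v, x) \<in> schreier.trav K s. m dvd f (v, x) - (p (schreier_act v (x, True)) - p v)"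
proof -
  define path where "path v = (SOME u. schreier.acts K u = v)" for v
  have path: "schreier.acts K (path v) = v" if "schreier.acts K u = v" for u v
    unfolding path_def using that by (rule someI)
  have "m dvd f (v, x) - (schreier.fsum f K (path (schreier_act v (x, True))) - schreier.fsum f K (path v))"
    if e: "(v, x) \<in> schreier.trav K s" for v x s
  proof -
    let ?w = "schreier_act v (x, True)"
    obtain u where "schreier.acts K u = v" using schreier.trav_reachable [OF e] by blast
    then have v: "schreier.acts K (path v) = v" "schreier.acts K (u @ [(x, True)]) = ?w"
      using path by auto
    then have w: "schreier.acts K (path ?w) = ?w" using path by blast
    have wK: "schreier.acts ?w (winv (path ?w)) = K"
      using schreier.acts_winv [of K "path ?w"] w by simp
    have "m dvd schreier.fsum f K (path v @ [(x, True)] @ winv (path ?w))"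
      using v wK by (intro schreier_fsum_dvd [OF S K]) auto
    also have "schreier.fsum f K (path v @ [(x, True)] @ winv (path ?w))
        = schreier.fsum f K (path v) + f (v, x) - schreier.fsum f K (path ?w)"
      using v w schreier.fsum_winv [of f K "path ?w"]
      by (simp add: schreier.val_def schreier.edge_def)
    finally show ?thesis by (simp add: algebra_simps)
  qed
  then show ?thesis by (intro exI [of _ "\<lambda>v. schreier.fsum f K (path v)"]) auto
qed

subsection \<open>Subgroups without cyclic quotients\<close>

text \<open>The assumption \<open>no_quotient\<close> says that the subgroup generated by \<open>H\<close> has no nontrivial
  homomorphism to the integers modulo twice the length of \<open>r\<close>: every nonzero assignment of
  residues to the generators is violated by some relation.\<close>

lemma word_eval_trivial_if_no_cyclic_quotient:
  fixes r :: "'x::wellorder letter list" and G (structure)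
  assumes G: "group G" and \<theta>: "\<And>x. \<theta> x \<in> carrier G" and r: "cyclically_reduced r"
    and relator: "word_eval G \<theta> r = \<one>" and fin: "finite H"
    and consequence: "\<And>U. fst ` set U \<subseteq> H \<Longrightarrow> word_eval G \<theta> (expand U) = \<one> \<Longrightarrow>
      \<exists>gs. free_reduce (expand (conjugates r gs)) = free_reduce (expand U)"
    and no_quotient: "\<And>a h. h \<in> H \<Longrightarrow> \<not> 2 * int (length r) dvd a h \<Longrightarrow>
      \<exists>U. fst ` set U \<subseteq> H \<and> word_eval G \<theta> (expand U) = \<one> \<and>
        \<not> 2 * int (length r) dvd exponent_sum a U"
    and "h \<in> H"
  shows "word_eval G \<theta> h = \<one>"
proof -
  interpret group G by fact
  interpret relator_action schreier_act "rotations r" "length r" "magnus_rank (rotations r)"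
    by (rule relator_action_rotations [OF r schreier.word_action_axioms])
  let ?m = "2 * int (length r)"
  have m: "0 < ?m" using N_pos by simp
  \<comment> \<open>The nonzero residue assignments. There are finitely many, so finitely many
    relations \<open>U a\<close>, with their expressions \<open>gs a\<close> as products of
    conjugates, refute them all.\<close>
  define A where "A = {a \<in> H \<rightarrow>\<^sub>E {0..<?m}. \<exists>h \<in> H. a h \<noteq> 0}"
  have "finite A" unfolding A_def using fin by (auto intro!: finite_PiE)
  have "\<exists>U gs. fst ` set U \<subseteq> H \<and> \<not> ?m dvd exponent_sum a U \<and>
      free_reduce (expand (conjugates r gs)) = free_reduce (expand U)" if a: "a \<in> A" for a
  proof -
    obtain h where "h \<in> H" "a h \<noteq> 0" using a by (auto simp: A_def)
    then have h: "h \<in> H" "a h \<noteq> 0" "a h \<in> {0..<?m}" using a PiE_mem by (fastforce simp: A_def)+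
    then have "\<not> ?m dvd a h" by (auto simp: zdvd_not_zless)
    from no_quotient [of h a, OF h(1) this] obtain U where U: "fst ` set U \<subseteq> H"
      "word_eval G \<theta> (expand U) = \<one>" "\<not> ?m dvd exponent_sum a U" by blast
    then show ?thesis using consequence [OF U(1,2)] by blast
  qed
  then obtain U gs where U: "\<And>a. a \<in> A \<Longrightarrow> fst ` set (U a) \<subseteq> H"
      "\<And>a. a \<in> A \<Longrightarrow> \<not> ?m dvd exponent_sum a (U a)"
      "\<And>a. a \<in> A \<Longrightarrow> free_reduce (expand (conjugates r (gs a))) = free_reduce (expand (U a))"
    by metis
  \<comment> \<open>With the conjugates of \<open>r\<close> among the generators of
    \<open>K\<close>, their paths close up and belong to \<open>E\<close>, so that each of them
    exhibits a circle there.\<close>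
  define C where "C = (\<Union>a \<in> A. fst ` set (conjugates r (gs a)))"
  define S where "S = H \<union> C"
  define K where "K = generate free_UNIV (free_reduce ` S)"
  define E where "E = (\<Union>s \<in> S. schreier.trav K s)"
  have "finite S" using fin \<open>finite A\<close> by (simp add: S_def C_def)
  then have finE: "finite E" by (simp add: E_def)
  interpret F: group "free_UNIV :: 'x letter list monoid" by (rule group_free_group)
  have K: "subgroup K free_UNIV"
    unfolding K_def by (rule F.generate_is_subgroup) (auto simp: carrier_free_UNIV)
  have closed: "schreier.acts K s = K" if "s \<in> S" for s
    using that schreier_acts_eq_iff [OF K, of s] by (simp add: K_def generate.incl)
  have cob: "coboundary ?m E f" if f: "cocycle ?m E f" for f
  proof -
    have sum_closed: "schreier.fsum f K (expand V) = exponent_sum (schreier.fsum f K) V"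
      if "fst ` set V \<subseteq> S" for V
      using that closed by (intro schreier.fsum_expand [THEN conjunct2]) force
    have C: "?m dvd schreier.fsum f K s" if s: "s \<in> C" for s
    proof -
      obtain a g where a: "a \<in> A" "s = g @ r @ winv g" using s by (auto simp: C_def conjugates_def)
      have sS: "s \<in> S" using s by (simp add: S_def)
      let ?v = "schreier.acts K g"
      have "schreier.acts (schreier.acts ?v r) (winv g) = K" using closed [OF sS] a by simp
      then have rv: "schreier.acts ?v r = ?v"
        using schreier.acts_winv [of "schreier.acts ?v r" "winv g"] by simp
      have "schreier.trav K s \<subseteq> E" using sS by (auto simp: E_def)
      then have "schreier.trav ?v r \<subseteq> E" using a by simp
      moreover have "r \<in> rotations r" unfolding rotations_def by (rule range_eqI [of _ _ 0]) simp
      ultimately have "(?v, r) \<in> circles E" using rv by (simp add: circles_def)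
      then have "?m dvd schreier.fsum f ?v r" using f by (force simp: cocycle_def)
      moreover have "schreier.fsum f K s = schreier.fsum f ?v r"
        using a rv schreier.fsum_winv [of f K g] by simp
      ultimately show ?thesis by simp
    qed
    have dvdC: "?m dvd exponent_sum (schreier.fsum f K) V" if "fst ` set V \<subseteq> C" for V
      using that by (induction V) (auto intro!: dvd_add dvd_diff C)
    have H: "?m dvd schreier.fsum f K h" if h: "h \<in> H" for h
    proof (rule ccontr)
      assume n: "\<not> ?m dvd schreier.fsum f K h"
      \<comment> \<open>The residues that the cocycle gives to \<open>H\<close>. If they are not all
        zero, the relation \<open>U a\<close> has nonzero sum modulo \<open>?m\<close> as a product
        over \<open>H\<close>, but zero sum as a product of conjugates of \<open>r\<close>.\<close>
      define a where "a = (\<lambda>h \<in> H. schreier.fsum f K h mod ?m)"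
      have "a h \<noteq> 0" using n h by (auto simp: a_def dvd_eq_mod_eq_0)
      then have a: "a \<in> A" using h m by (auto simp: A_def a_def)
      have congr: "?m dvd exponent_sum a V - exponent_sum (schreier.fsum f K) V"
        if "fst ` set V \<subseteq> H" for V
        using that
      proof (induction V)
        case (Cons p V)
        obtain h b where p: "p = (h, b)" by (cases p)
        have 1: "?m dvd a h - schreier.fsum f K h"
          using Cons.prems p by (simp add: a_def mod_eq_dvd_iff [symmetric])
        then have 2: "?m dvd schreier.fsum f K h - a h" by (simp only: dvd_diff_commute)
        have 3: "?m dvd exponent_sum a V - exponent_sum (schreier.fsum f K) V" using Cons by simp
        show ?case using dvd_add [OF 1 3] dvd_add [OF 2 3] p by (simp add: algebra_simps)
      qed simp
      have "fst ` set (conjugates r (gs a)) \<subseteq> C" using a by (auto simp: C_def)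
      then have "?m dvd schreier.fsum f K (expand (conjugates r (gs a)))"
        using dvdC sum_closed [of "conjugates r (gs a)"] by (simp add: S_def le_supI2)
      moreover have "schreier.fsum f K (expand (conjugates r (gs a))) = schreier.fsum f K (expand (U a))"
        using U(3) [OF a] by (metis schreier.fsum_free_reduce)
      moreover have "schreier.fsum f K (expand (U a)) = exponent_sum (schreier.fsum f K) (U a)"
        using sum_closed U(1) [OF a] by (simp add: S_def le_supI1)
      ultimately have "?m dvd exponent_sum (schreier.fsum f K) (U a)" by simp
      then have "?m dvd exponent_sum a (U a)" using congr [OF U(1) [OF a]] dvd_diff_right_iff by (metis dvd_add_left_iff diff_add_cancel)
      then show False using U(2) [OF a] by simp
    qed
    have "?m dvd schreier.fsum f K s" if "s \<in> S" for s
      using that C H by (auto simp: S_def)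
    from schreier_potential [OF this K_def] show ?thesis
      by (auto simp: coboundary_def E_def)
  qed
  have rot: "word_eval G \<theta> u = \<one>" if "u \<in> rotations r" for u
  proof -
    have "word_eval G \<theta> (rotate i r) = \<one>" for i
    proof (induction i)
      case (Suc i)
      obtain l w where lw: "rotate i r = l # w"
        using r by (cases "rotate i r") (auto simp: cyclically_reduced_def)
      let ?g = "if snd l then \<theta> (fst l) else inv (\<theta> (fst l))"
      have "?g \<otimes> word_eval G \<theta> w = \<one>" using Suc lw by simp
      then have "word_eval G \<theta> w \<otimes> ?g = \<one>" by (rule inv_comm) (use \<theta> in auto)
      moreover have "rotate (Suc i) r = w @ [l]" using lw by simp
      ultimately show ?case using \<theta> word_eval_append [of \<theta> w "[l]", OF \<theta>] by simp
    qed (simp add: relator)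
    then show ?thesis using that by (auto simp: rotations_def)
  qed
  have "\<exists>P. (\<forall>v. P v \<in> carrier G) \<and>
      (\<forall>(v, x) \<in> E. P (schreier_act v (x, True)) = P v \<otimes> \<theta> x)"
    by (rule potential_exists [OF G _ _ finE]) (fact \<theta> rot cob)+
  then obtain P where P': "\<forall>v. P v \<in> carrier G"
      "\<forall>(v, x) \<in> E. P (schreier_act v (x, True)) = P v \<otimes> \<theta> x"
    by (elim exE conjE)
  have P: "\<And>v. P v \<in> carrier G"
    "\<And>v x. (v, x) \<in> E \<Longrightarrow> P (schreier_act v (x, True)) = P v \<otimes> \<theta> x"
    using P' by auto
  have hS: "h \<in> S" using \<open>h \<in> H\<close> by (simp add: S_def)
  then have "schreier.trav K h \<subseteq> E" by (auto simp: E_def)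
  then have "P (schreier.acts K h) = P K \<otimes> word_eval G \<theta> h"
    by (rule schreier.word_eval_potential [OF G, rotated -1]) (fact \<theta> P)+
  then have "P K = P K \<otimes> word_eval G \<theta> h" using closed [OF hS] by simp
  then show ?thesis using P(1) [of K] word_eval_closed [of \<theta> h, OF \<theta>] by simp
qed

subsection \<open>Finite-index subgroups\<close>

context group
begin

text \<open>Used with \<open>J = UNIV\<close> for the subgroup generated by the words, and with the
  multiples of \<open>m\<close> for the kernel of a residue map.\<close>

lemma subgroup_exponent_sum:
  assumes \<theta>: "\<And>x. \<theta> x \<in> carrier G" and "0 \<in> J" "\<And>i j. i \<in> J \<Longrightarrow> j \<in> J \<Longrightarrow> i + j \<in> J"
    "\<And>i. i \<in> J \<Longrightarrow> - i \<in> J"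
  shows "subgroup {word_eval G \<theta> (expand U) | U. fst ` set U \<subseteq> H \<and> exponent_sum a U \<in> J} G"
    (is "subgroup ?N G")
proof (rule subgroupI)
  show "?N \<subseteq> carrier G" using \<theta> by auto
  show "?N \<noteq> {}"
    using assms(2) by (auto intro!: exI [of _ "[]"])
next
  fix x assume "x \<in> ?N"
  then obtain U where "x = word_eval G \<theta> (expand U)" "fst ` set U \<subseteq> H" "exponent_sum a U \<in> J" by auto
  then have "inv x = word_eval G \<theta> (expand (expand_inv U)) \<and> fst ` set (expand_inv U) \<subseteq> H \<and>
      exponent_sum a (expand_inv U) \<in> J"
    using word_eval_winv [of \<theta>, OF \<theta>] assms(4) by simp
  then show "inv x \<in> ?N" by blast
next
  fix x y assume "x \<in> ?N" "y \<in> ?N"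
  then obtain U V where "x = word_eval G \<theta> (expand U)" "fst ` set U \<subseteq> H" "exponent_sum a U \<in> J"
    "y = word_eval G \<theta> (expand V)" "fst ` set V \<subseteq> H" "exponent_sum a V \<in> J" by auto
  then have "x \<otimes> y = word_eval G \<theta> (expand (U @ V)) \<and> fst ` set (U @ V) \<subseteq> H \<and>
      exponent_sum a (U @ V) \<in> J"
    using word_eval_append [of \<theta>, OF \<theta>] assms(3) by (simp add: image_Un)
  then show "x \<otimes> y \<in> ?N" by blast
qed

lemma generate_word_eval:
  assumes \<theta>: "\<And>x. \<theta> x \<in> carrier G"
  shows "generate G (word_eval G \<theta> ` H) = {word_eval G \<theta> (expand U) | U. fst ` set U \<subseteq> H}"
    (is "_ = ?M")
proof
  have "subgroup ?M G" using subgroup_exponent_sum [of \<theta> UNIV H] \<theta> by simp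
  moreover have "word_eval G \<theta> ` H \<subseteq> ?M"
  proof clarify
    fix h assume "h \<in> H"
    then show "\<exists>U. word_eval G \<theta> h = word_eval G \<theta> (expand U) \<and> fst ` set U \<subseteq> H"
      by (intro exI [of _ "[(h, True)]"]) simp
  qed
  ultimately show "generate G (word_eval G \<theta> ` H) \<subseteq> ?M" by (intro generate_subgroup_incl)
  have "word_eval G \<theta> (expand U) \<in> generate G (word_eval G \<theta> ` H)" if "fst ` set U \<subseteq> H" for U
    using that
  proof (induction U)
    case Nil
    then show ?case by (simp add: generate.one)
  next
    case (Cons p U)
    obtain h b where p: "p = (h, b)" by (cases p)
    then have "h \<in> H" using Cons.prems by simp
    then have "word_eval G \<theta> (if b then h else winv h) \<in> generate G (word_eval G \<theta> ` H)"
      using word_eval_winv [of \<theta>, OF \<theta>] by (auto intro: generate.incl generate.inv)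
    then show ?case
      using Cons p word_eval_append [of \<theta>, OF \<theta>] by (auto intro!: generate.eng)
  qed
  then show "?M \<subseteq> generate G (word_eval G \<theta> ` H)" by auto
qed

text \<open>By \<open>hom\<close> the exponent sum modulo \<open>m\<close> is a well-defined
  homomorphism on the generated subgroup. \<open>N\<close> is its kernel, proper because of
  \<open>h\<close>, and \<open>D\<close> has a representative for each residue attained.\<close>

lemma finite_index_if_cyclic_quotient:
  fixes m :: int
  assumes \<theta>: "\<And>x. \<theta> x \<in> carrier G" and m: "0 < m"
    and h: "h \<in> H" "\<not> m dvd a h"
    and hom: "\<And>U. fst ` set U \<subseteq> H \<Longrightarrow> word_eval G \<theta> (expand U) = \<one> \<Longrightarrow> m dvd exponent_sum a U"
  shows "\<exists>N D. subgroup N G \<and> N \<subset> generate G (word_eval G \<theta> ` H) \<and> finite D \<and> D \<subseteq> carrier G \<and>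
    generate G (word_eval G \<theta> ` H) = N <#> D"
proof -
  let ?M = "{word_eval G \<theta> (expand U) | U. fst ` set U \<subseteq> H}"
  let ?N = "{word_eval G \<theta> (expand U) | U. fst ` set U \<subseteq> H \<and> exponent_sum a U \<in> {i. m dvd i}}"
  note M = generate_word_eval [of \<theta> H, OF \<theta>]
  have N: "subgroup ?N G" by (rule subgroup_exponent_sum) (use \<theta> in auto)
  have hM: "word_eval G \<theta> h \<in> ?M" using h by (auto intro!: exI [of _ "[(h, True)]"])
  have hN: "word_eval G \<theta> h \<notin> ?N"
  proof
    assume "word_eval G \<theta> h \<in> ?N"
    then obtain U where U: "word_eval G \<theta> h = word_eval G \<theta> (expand U)" "fst ` set U \<subseteq> H"
      "m dvd exponent_sum a U" by auto
    have "word_eval G \<theta> (expand (expand_inv U @ [(h, True)])) = \<one>"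
      using U(1) \<theta> by (simp add: word_eval_append word_eval_winv)
    moreover have "fst ` set (expand_inv U @ [(h, True)]) \<subseteq> H" using U(2) h by (simp add: image_Un)
    ultimately have "m dvd exponent_sum a (expand_inv U @ [(h, True)])" using hom by blast
    then have "m dvd a h - exponent_sum a U" by simp
    then have "m dvd (a h - exponent_sum a U) + exponent_sum a U" using U(3) by (rule dvd_add)
    then show False using h(2) by simp
  qed
  define rep where "rep c U \<longleftrightarrow> fst ` set U \<subseteq> H \<and> exponent_sum a U mod m = c" for c U
  define D where "D = (\<lambda>c. word_eval G \<theta> (expand (SOME U. rep c U))) ` {c \<in> {0..<m}. \<exists>U. rep c U}"
  have "finite {c \<in> {0..<m}. \<exists>U. rep c U}" by (rule finite_subset [of _ "{0..<m}"]) auto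
  then have "finite D" unfolding D_def by (rule finite_imageI)
  have DM: "D \<subseteq> ?M"
  proof
    fix d assume "d \<in> D"
    then obtain c where c: "\<exists>U. rep c U" "d = word_eval G \<theta> (expand (SOME U. rep c U))"
      by (auto simp: D_def)
    have "rep c (SOME U. rep c U)" using c(1) by (rule someI_ex)
    then show "d \<in> ?M" using c(2) unfolding rep_def by blast
  qed
  have "?M = ?N <#> D"
  proof
    show "?M \<subseteq> ?N <#> D"
    proof
      fix g assume "g \<in> ?M"
      then obtain U where U: "g = word_eval G \<theta> (expand U)" "fst ` set U \<subseteq> H" by auto
      let ?c = "exponent_sum a U mod m"
      let ?V = "SOME V. rep ?c V"
      have "rep ?c U" using U by (simp add: rep_def)
      then have V: "rep ?c ?V" by (rule someI)
      have "word_eval G \<theta> (expand ?V) \<in> D"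
        unfolding D_def using \<open>rep ?c U\<close> m by (intro imageI) auto
      moreover have "word_eval G \<theta> (expand (U @ expand_inv ?V)) \<in> ?N"
      proof -
        have "fst ` set (U @ expand_inv ?V) \<subseteq> H" using U V by (auto simp: rep_def image_Un)
        moreover have "m dvd exponent_sum a (U @ expand_inv ?V)"
          using V by (simp add: rep_def mod_eq_dvd_iff [symmetric])
        ultimately show ?thesis by blast
      qed
      moreover have "g = word_eval G \<theta> (expand (U @ expand_inv ?V)) \<otimes> word_eval G \<theta> (expand ?V)"
        using \<theta> by (simp add: U word_eval_append word_eval_winv m_assoc)
      ultimately show "g \<in> ?N <#> D" unfolding set_mult_def by blast
    qed
    show "?N <#> D \<subseteq> ?M"
    proof
      fix g assume "g \<in> ?N <#> D"
      then obtain n d where nd: "n \<in> ?N" "d \<in> D" "g = n \<otimes> d" unfolding set_mult_def by blast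
      have sub: "subgroup ?M G" using subgroup_exponent_sum [of \<theta> UNIV H] \<theta> by simp
      have "n \<in> ?M" "d \<in> ?M" using nd DM by auto
      then show "g \<in> ?M" unfolding nd(3) by (rule subgroup.m_closed [OF sub])
    qed
  qed
  moreover have "?N \<subset> ?M" using hM hN by blast
  moreover have "D \<subseteq> carrier G" using DM \<theta> by auto
  ultimately show ?thesis unfolding M
    by (intro exI [of _ ?N] exI [of _ D] conjI N \<open>finite D\<close>)
qed

end

subsection \<open>Consequences of a relator\<close>

lemma free_reduce_cancel:
  "free_reduce (u @ winv g @ g @ v) = free_reduce (u @ v)"
  "free_reduce (u @ g @ winv g @ v) = free_reduce (u @ v)"
proof -
  have *: "free_reduce (u @ c @ v) = free_reduce (u @ v)" if "free_reduce c = []" for c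
  proof -
    have "free_reduce (c @ v) = free_reduce ([] @ v)"
      by (rule free_reduce_append_cong) (use that in simp_all)
    then show ?thesis by (intro free_reduce_append_cong) simp_all
  qed
  show "free_reduce (u @ winv g @ g @ v) = free_reduce (u @ v)"
    using * [of "winv g @ g"] by simp
  show "free_reduce (u @ g @ winv g @ v) = free_reduce (u @ v)"
    using * [of "g @ winv g"] by simp
qed

lemma free_reduce_winv_cong:
  assumes "free_reduce u = free_reduce v"
  shows "free_reduce (winv u) = free_reduce (winv v)"
proof -
  have "free_reduce (winv u) = free_reduce (winv u @ v @ winv v)"
    using free_reduce_cancel(2) [of "winv u" v "[]"] by simp
  also have "\<dots> = free_reduce (winv u @ u @ winv v)"
    by (intro free_reduce_append_cong assms [symmetric]) simp_all
  also have "\<dots> = free_reduce (winv v)"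
    using free_reduce_cancel(1) [of "[]" u "winv v"] by simp
  finally show ?thesis .
qed

lemma expand_conjugates_conjugate:
  "free_reduce (x @ expand (conjugates r gs) @ winv x) =
   free_reduce (expand (conjugates r (map (\<lambda>(g, b). (x @ g, b)) gs)))"
proof (induction gs)
  case (Cons p gs)
  obtain g b where p: "p = (g, b)" by (cases p)
  let ?k = "if b then g @ r @ winv g else winv (g @ r @ winv g)"
  let ?c = "expand (conjugates r gs)"
  have "free_reduce (x @ (?k @ ?c) @ winv x) = free_reduce ((x @ ?k) @ winv x @ x @ (?c @ winv x))"
    using free_reduce_cancel(1) [of "x @ ?k" x "?c @ winv x"] by simp
  also have "\<dots> = free_reduce ((x @ ?k @ winv x) @ (x @ ?c @ winv x))" by simp
  also have "\<dots> = free_reduce ((x @ ?k @ winv x) @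
      expand (conjugates r (map (\<lambda>(g, b). (x @ g, b)) gs)))"
    by (rule free_reduce_append_cong) (use Cons in simp_all)
  finally show ?case using p by (auto simp: conjugates_def)
qed (simp add: conjugates_def)

text \<open>The reduced products of conjugates of \<open>r\<close> that lie over \<open>X\<close>
  form a normal subgroup containing \<open>r\<close>. The conjugating words are arbitrary; only the
  reduced product has to lie in the group.\<close>

lemma normal_closure_consequence:
  assumes r: "r \<in> carrier (free_group X)" and w: "w \<in> normal_closure (free_group X) {r}"
  shows "\<exists>gs. free_reduce (expand (conjugates r gs)) = w"
proof -
  interpret group "free_group X" by (rule group_free_group)
  let ?Q = "{w \<in> carrier (free_group X). \<exists>gs. free_reduce (expand (conjugates r gs)) = w}"
  have sub: "subgroup ?Q (free_group X)"
  proof (rule subgroupI)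
    have "\<one>\<^bsub>free_group X\<^esub> \<in> ?Q"
      by (auto simp: one_free_group conjugates_def free_group_def intro!: exI [of _ "[]"])
    then show "?Q \<noteq> {}" by blast
  next
    fix a assume a: "a \<in> ?Q"
    then obtain gs where gs: "free_reduce (expand (conjugates r gs)) = a" by blast
    have "free_reduce (winv (expand (conjugates r gs))) = free_reduce (winv a)"
      using gs by (intro free_reduce_winv_cong) (metis free_reduce_idem)
    moreover have "expand (conjugates r (map (\<lambda>(g, b). (g, \<not> b)) (rev gs))) = winv (expand (conjugates r gs))"
    proof -
      have "conjugates r (map (\<lambda>(g, b). (g, \<not> b)) (rev gs)) = expand_inv (conjugates r gs)"
        by (simp add: conjugates_def expand_inv_def rev_map case_prod_unfold)
      then show ?thesis by simp
    qed
    moreover have "free_reduce (winv a) = winv a"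
      using a reduced_winv by (intro free_reduce_reduced) (auto simp: free_group_def)
    moreover have "inv\<^bsub>free_group X\<^esub> a = winv a" using a by (intro inv_free_group) simp
    ultimately have "free_reduce (expand (conjugates r (map (\<lambda>(g, b). (g, \<not> b)) (rev gs)))) =
        inv\<^bsub>free_group X\<^esub> a" by simp
    then have "\<exists>gs. free_reduce (expand (conjugates r gs)) = inv\<^bsub>free_group X\<^esub> a" by blast
    then show "inv\<^bsub>free_group X\<^esub> a \<in> ?Q" using a by simp
  next
    fix a b assume ab: "a \<in> ?Q" "b \<in> ?Q"
    then obtain gs hs where gs: "free_reduce (expand (conjugates r gs)) = a"
      "free_reduce (expand (conjugates r hs)) = b" by blast
    have "free_reduce (expand (conjugates r (gs @ hs))) = free_reduce (a @ b)"
      unfolding conjugates_def map_append expand_simps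
      by (rule free_reduce_append_cong) (use gs in \<open>auto simp: conjugates_def\<close>)
    then have "\<exists>gs. free_reduce (expand (conjugates r gs)) = a \<otimes>\<^bsub>free_group X\<^esub> b"
      by (metis mult_free_group)
    then show "a \<otimes>\<^bsub>free_group X\<^esub> b \<in> ?Q" using ab by simp
  qed auto
  have "?Q \<lhd> free_group X"
    unfolding normal_inv_iff
  proof (intro conjI sub ballI)
    fix x h assume x: "x \<in> carrier (free_group X)" and h: "h \<in> ?Q"
    then obtain gs where gs: "free_reduce (expand (conjugates r gs)) = h" by blast
    have "x \<otimes>\<^bsub>free_group X\<^esub> h \<otimes>\<^bsub>free_group X\<^esub> inv\<^bsub>free_group X\<^esub> x = free_reduce ((x @ h) @ winv x)"
      unfolding mult_free_group inv_free_group [OF x]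
      by (rule free_reduce_append_cong) simp_all
    also have "\<dots> = free_reduce (x @ h @ winv x)" by simp
    also have "\<dots> = free_reduce (x @ expand (conjugates r gs) @ winv x)"
      using gs by (intro free_reduce_append_cong) (auto simp del: gs)
    also have "\<dots> = free_reduce (expand (conjugates r (map (\<lambda>(g, b). (x @ g, b)) gs)))"
      by (rule expand_conjugates_conjugate)
    finally have "\<exists>gs. free_reduce (expand (conjugates r gs)) =
        x \<otimes>\<^bsub>free_group X\<^esub> h \<otimes>\<^bsub>free_group X\<^esub> inv\<^bsub>free_group X\<^esub> x" by (metis (no_types))
    moreover have "h \<in> carrier (free_group X)" using h by simp
    ultimately show "x \<otimes>\<^bsub>free_group X\<^esub> h \<otimes>\<^bsub>free_group X\<^esub> inv\<^bsub>free_group X\<^esub> x \<in> ?Q"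
      using x by simp
  qed
  moreover have "free_reduce (expand (conjugates r [([], True)])) = r"
    using r by (simp add: conjugates_def free_group_def free_reduce_reduced)
  then have "r \<in> ?Q" using r by blast
  ultimately have "normal_closure (free_group X) {r} \<subseteq> ?Q"
    unfolding normal_closure_def by blast
  then show ?thesis using w by blast
qed

lemma cyclic_reduction:
  assumes "reduced r"
  shows "\<exists>a r0. r = a @ r0 @ winv a \<and> (r0 = [] \<or> cyclically_reduced r0)"
  using assms
proof (induction "length r" arbitrary: r rule: less_induct)
  case less
  show ?case
  proof (cases "r = [] \<or> cyclically_reduced r")
    case True
    then show ?thesis by (intro exI [of _ "[]"] exI [of _ r]) simp
  next
    case False
    then have hl: "r \<noteq> []" "hd r = letter_inv (last r)"
      using less.prems by (auto simp: cyclically_reduced_def)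
    obtain l w where lw: "r = l # w" using hl by (cases r) auto
    have "w \<noteq> []"
    proof
      assume "w = []"
      then have "l = letter_inv l" using hl lw by simp
      then show False by (simp add: letter_inv_def prod_eq_iff)
    qed
    then obtain u k where w: "w = u @ [k]" by (metis append_butlast_last_id)
    have k: "k = letter_inv l" using hl lw w by simp
    have "reduced u" using less.prems lw w
      by (auto simp: reduced_def successively_append_iff successively_Cons)
    then obtain a r0 where "u = a @ r0 @ winv a" "r0 = [] \<or> cyclically_reduced r0"
      using less.hyps [of u] lw w by auto
    then show ?thesis using lw w k by (intro exI [of _ "l # a"] exI [of _ r0]) simp
  qed
qed

text \<open>Allows the relator to be replaced by its cyclic reduction: products of conjugates of the
  former are products of conjugates of the latter.\<close>

lemma conjugates_conjugate:
  "conjugates (a @ r @ winv a) gs = conjugates r (map (\<lambda>(g, b). (g @ a, b)) gs)"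
  by (simp add: conjugates_def case_prod_unfold)

subsection \<open>One-relator groups\<close>

lemma word_eval_presentation:
  assumes "group G" and N: "N \<lhd> free_group X" and \<phi>: "\<phi> \<in> hom (free_group X Mod N) G"
    and \<theta>: "\<And>x. x \<in> X \<Longrightarrow> \<theta> x = \<phi> (N #>\<^bsub>free_group X\<^esub> [(x, True)])"
    and "fst ` set u \<subseteq> X"
  shows "word_eval G \<theta> u = \<phi> (N #>\<^bsub>free_group X\<^esub> free_reduce u)"
proof -
  interpret G: group G by fact
  interpret F: group "free_group X" by (rule group_free_group)
  interpret N: normal N "free_group X" by fact
  interpret \<phi>: group_hom "free_group X Mod N" G \<phi>
    using N.factorgroup_is_group \<phi> by (intro group_hom.intro group_hom_axioms.intro G.is_group)
  let ?q = "\<lambda>u. N #>\<^bsub>free_group X\<^esub> u"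
  have car: "?q u \<in> carrier (free_group X Mod N)" if "u \<in> carrier (free_group X)" for u
    using that N.subset by (simp add: FactGroup_def F.rcosetsI)
  have mult: "\<phi> (?q (free_reduce (u @ v))) = \<phi> (?q u) \<otimes>\<^bsub>G\<^esub> \<phi> (?q v)"
    if "u \<in> carrier (free_group X)" "v \<in> carrier (free_group X)" for u v
    using \<phi>.hom_mult [OF car [OF that(1)] car [OF that(2)]] N.rcos_sum [OF that]
    by (simp add: FactGroup_def mult_free_group)
  have one: "\<phi> (?q []) = \<one>\<^bsub>G\<^esub>"
    using \<phi>.hom_one F.coset_mult_one [OF N.subset] by (simp add: FactGroup_def one_free_group)
  show ?thesis using assms(5)
  proof (induction u)
    case Nil
    then show ?case by (simp add: one)
  next
    case (Cons l u)
    have letter: "[(x, b)] \<in> carrier (free_group X)" if "x \<in> X" for x b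
      using that by (simp add: free_group_def reduced_Cons)
    have u: "free_reduce u \<in> carrier (free_group X)"
      using Cons.prems set_foldr [of u "[]"] by (auto simp: free_group_def free_reduce_def reduced_foldr)
    obtain x b where l: "l = (x, b)" by (cases l)
    have x: "x \<in> X" using Cons.prems l by simp
    have 1: "(if snd l then \<theta> (fst l) else inv\<^bsub>G\<^esub> \<theta> (fst l)) = \<phi> (?q [l])"
    proof (cases b)
      case False
      have "free_reduce ([(x, False)] @ [(x, True)]) = []"
        by (simp add: free_reduce_def letter_inv_def)
      then have "\<phi> (?q [(x, False)]) \<otimes>\<^bsub>G\<^esub> \<phi> (?q [(x, True)]) = \<one>\<^bsub>G\<^esub>"
        using mult [OF letter [OF x] letter [OF x], of False True] one by simp
      then have "inv\<^bsub>G\<^esub> \<phi> (?q [(x, True)]) = \<phi> (?q [(x, False)])"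
        using car letter [OF x] by (intro G.inv_equality) auto
      then show ?thesis using l False \<theta> [OF x] by simp
    qed (use l \<theta> [OF x] in simp)
    have 2: "free_reduce (l # u) = free_reduce ([l] @ free_reduce u)"
      using free_reduce_append_cong [of "[l]" "[l]" u "free_reduce u"] by simp
    have 3: "word_eval G \<theta> u = \<phi> (?q (free_reduce u))" using Cons by simp
    show ?case
      unfolding word_eval.simps 1 2 3 using mult [OF letter [OF x, of b] u] l by simp
  qed
qed

lemma (in group) conjugate_eq_one_iff:
  assumes "x \<in> carrier G" "y \<in> carrier G"
  shows "x \<otimes> (y \<otimes> inv x) = \<one> \<longleftrightarrow> y = \<one>"
proof
  assume "x \<otimes> (y \<otimes> inv x) = \<one>"
  then have "inv x \<otimes> (x \<otimes> (y \<otimes> inv x)) \<otimes> x = inv x \<otimes> \<one> \<otimes> x" by simp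
  then show "y = \<one>" using assms by (simp add: m_assoc)
qed (use assms in simp)

text \<open>The form in which the presentation is used: words evaluated in \<open>G\<close> itself,
  a relator that is nonempty and cyclically reduced, and relations of \<open>G\<close> witnessed by
  an equality of reduced words.\<close>

lemma one_relator_group_words:
  fixes G (structure)
  assumes "one_relator_group G"
  obtains \<theta> :: "nat \<Rightarrow> 'a" and X r where "\<And>x. \<theta> x \<in> carrier G" "cyclically_reduced r"
    "word_eval G \<theta> r = \<one>"
    "\<And>g. g \<in> carrier G \<Longrightarrow> \<exists>u. fst ` set u \<subseteq> X \<and> word_eval G \<theta> u = g"
    "\<And>u. fst ` set u \<subseteq> X \<Longrightarrow> word_eval G \<theta> u = \<one> \<Longrightarrow>
      \<exists>gs. free_reduce (expand (conjugates r gs)) = free_reduce u"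
proof -
  obtain X :: "nat set" and r where G: "group G" and X: "finite X" and r: "r \<in> carrier (free_group X)"
    and iso: "G \<cong> presented_group X {r}"
    using assms by (auto simp: one_relator_group_def)
  interpret group G by fact
  interpret F: group "free_group X" by (rule group_free_group)
  let ?N = "normal_closure (free_group X) {r}"
  have N: "?N \<lhd> free_group X" using F.normal_normal_closure r by simp
  interpret N: normal ?N "free_group X" by fact
  obtain \<phi> where \<phi>: "\<phi> \<in> iso (free_group X Mod ?N) G"
    using iso_sym [OF iso] by (auto simp: is_iso_def presented_group_def)
  then have hom: "\<phi> \<in> hom (free_group X Mod ?N) G"
    and bij: "bij_betw \<phi> (carrier (free_group X Mod ?N)) (carrier G)"
    by (auto simp: iso_def)
  let ?q = "\<lambda>u. ?N #>\<^bsub>free_group X\<^esub> u"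
  have car: "?q u \<in> carrier (free_group X Mod ?N)" if "u \<in> carrier (free_group X)" for u
    using that N.subset by (simp add: FactGroup_def F.rcosetsI)
  \<comment> \<open>The value 1 outside \<open>X\<close> makes \<open>\<theta>\<close> total and
    lets a letter outside \<open>X\<close> hold as a relator below.\<close>
  define \<theta> where "\<theta> x = (if x \<in> X then \<phi> (?q [(x, True)]) else \<one>)" for x
  have \<theta>: "\<theta> x \<in> carrier G" for x
  proof (cases "x \<in> X")
    case True
    then have "[(x, True)] \<in> carrier (free_group X)" by (simp add: free_group_def reduced_Cons)
    then show ?thesis using True car bij_betw_apply [OF bij] by (simp add: \<theta>_def)
  qed (simp add: \<theta>_def)
  have eval: "word_eval G \<theta> u = \<phi> (?q (free_reduce u))" if "fst ` set u \<subseteq> X" for u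
    by (rule word_eval_presentation [OF G N hom _ that]) (simp add: \<theta>_def)
  have surj: "\<exists>u. fst ` set u \<subseteq> X \<and> word_eval G \<theta> u = g" if g: "g \<in> carrier G" for g
  proof -
    have "g \<in> \<phi> ` carrier (free_group X Mod ?N)"
      using g bij_betw_imp_surj_on [OF bij] by simp
    then obtain c where c: "g = \<phi> c" "c \<in> carrier (free_group X Mod ?N)" by (rule imageE)
    from c(2) obtain w where w: "w \<in> carrier (free_group X)" "c = ?q w"
      unfolding FactGroup_def RCOSETS_def by auto
    then have "fst ` set w \<subseteq> X" "free_reduce w = w" by (auto simp: free_group_def free_reduce_reduced)
    then show ?thesis using eval [of w] c w by auto
  qed
  have carrier_reduce: "free_reduce u \<in> carrier (free_group X)" if "fst ` set u \<subseteq> X" for u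
    using that set_foldr [of u "[]"] by (auto simp: free_group_def free_reduce_def reduced_foldr)
  have kernel: "\<exists>gs. free_reduce (expand (conjugates r gs)) = free_reduce u"
    if u: "fst ` set u \<subseteq> X" "word_eval G \<theta> u = \<one>" for u
  proof -
    note q = car [OF carrier_reduce [OF u(1)]]
    have one: "\<one>\<^bsub>free_group X Mod ?N\<^esub> = ?N" by (simp add: FactGroup_def)
    have "\<phi> (?q (free_reduce u)) = \<phi> ?N"
      using eval [OF u(1)] u(2) hom_one [OF hom N.factorgroup_is_group G] one by simp
    moreover have "?N \<in> carrier (free_group X Mod ?N)"
      using monoid.one_closed [OF group.is_monoid [OF N.factorgroup_is_group]] one by simp
    ultimately have "?q (free_reduce u) = ?N"
      using bij_betw_imp_inj_on [OF bij] q by (auto dest: inj_onD)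
    then have "free_reduce u \<in> ?N"
      by (rule F.coset_join1) (use carrier_reduce [OF u(1)] N.subgroup_axioms in auto)
    then show ?thesis by (rule normal_closure_consequence [OF r])
  qed
  have rX: "fst ` set r \<subseteq> X" and red: "reduced r" using r by (auto simp: free_group_def)
  have "r \<in> ?N" by (auto simp: normal_closure_def)
  then have "?q r = ?N" by (intro F.coset_join2 r N.subgroup_axioms)
  then have eval_r: "word_eval G \<theta> r = \<one>"
    using eval [OF rX] free_reduce_reduced [OF red] hom_one [OF hom N.factorgroup_is_group G]
    by (simp add: FactGroup_def)
  obtain a r0 where r0: "r = a @ r0 @ winv a" "r0 = [] \<or> cyclically_reduced r0"
    using cyclic_reduction [OF red] by blast
  show thesis
  proof (cases "r0 = []")
    case True
    text \<open>The group is free on \<open>X\<close>; a generator outside \<open>X\<close> serves as the relator.\<close>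
    obtain z where z: "z \<notin> X" using X ex_new_if_finite infinite_UNIV_nat by blast
    show thesis
    proof (rule that [of \<theta> "[(z, True)]" X])
      show "cyclically_reduced [(z, True)]"
        by (simp add: cyclically_reduced_def reduced_Cons letter_inv_def)
      show "word_eval G \<theta> [(z, True)] = \<one>" using z by (simp add: \<theta>_def)
      fix u assume u: "fst ` set u \<subseteq> X" "word_eval G \<theta> u = \<one>"
      obtain gs where "free_reduce (expand (conjugates r gs)) = free_reduce u" using kernel [OF u] by blast
      moreover have "free_reduce (expand (conjugates (a @ winv a) gs)) = []"
      proof (induction gs)
        case (Cons p gs)
        obtain g b where p: "p = (g, b)" by (cases p)
        let ?k = "g @ (a @ winv a) @ winv g"
        have "free_reduce ?k = []"
          using free_reduce_cancel(2) [of g a "winv g"] by simp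
        then have "free_reduce (?k @ expand (conjugates (a @ winv a) gs)) = free_reduce ([] @ [])"
          using Cons by (intro free_reduce_append_cong) simp_all
        then show ?case by (simp add: p conjugates_def)
      qed (simp add: conjugates_def)
      ultimately have "free_reduce u = []" using r0(1) True by simp
      then show "\<exists>gs. free_reduce (expand (conjugates [(z, True)] gs)) = free_reduce u"
        by (intro exI [of _ "[]"]) (simp add: conjugates_def)
    qed (use \<theta> surj in auto)
  next
    case False
    show thesis
    proof (rule that [of \<theta> r0 X])
      show "cyclically_reduced r0" using r0 False by simp
      have "word_eval G \<theta> a \<otimes> (word_eval G \<theta> r0 \<otimes> inv (word_eval G \<theta> a)) = \<one>"
        using eval_r \<theta> by (simp add: r0(1) word_eval_append word_eval_winv)
      then show "word_eval G \<theta> r0 = \<one>"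
        using conjugate_eq_one_iff \<theta> by simp
      fix u assume u: "fst ` set u \<subseteq> X" "word_eval G \<theta> u = \<one>"
      show "\<exists>gs. free_reduce (expand (conjugates r0 gs)) = free_reduce u"
        using kernel [OF u] unfolding r0(1) conjugates_conjugate by blast
    qed (use \<theta> surj in auto)
  qed
qed

theorem corollaryB:
  fixes G :: "('a, 'b) monoid_scheme"
  assumes "one_relator_group G"
  shows "monotileable G"
proof -
  interpret group G using assms by (simp add: one_relator_group_def)
  obtain \<theta> :: "nat \<Rightarrow> 'a" and X r where \<theta>: "\<And>x. \<theta> x \<in> carrier G" and r: "cyclically_reduced r"
    "word_eval G \<theta> r = \<one>\<^bsub>G\<^esub>"
    and surj: "\<And>g. g \<in> carrier G \<Longrightarrow> \<exists>u. fst ` set u \<subseteq> X \<and> word_eval G \<theta> u = g"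
    and kernel: "\<And>u. fst ` set u \<subseteq> X \<Longrightarrow> word_eval G \<theta> u = \<one>\<^bsub>G\<^esub> \<Longrightarrow>
      \<exists>gs. free_reduce (expand (conjugates r gs)) = free_reduce u"
    by (rule one_relator_group_words [OF assms]) (rule that; blast)
  let ?m = "2 * int (length r)"
  show ?thesis
  proof (rule monotileable_if_locally_finite_index)
    fix A assume A: "A \<subseteq> carrier G" "finite A" "generate G A \<noteq> {\<one>\<^bsub>G\<^esub>}"
    obtain w where w: "\<And>g. g \<in> A \<Longrightarrow> fst ` set (w g) \<subseteq> X \<and> word_eval G \<theta> (w g) = g"
      using surj A(1) by (metis subsetD)
    let ?H = "w ` A"
    have AH: "word_eval G \<theta> ` ?H = A" using w by (force simp: image_image)
    have HX: "fst ` set (expand U) \<subseteq> X" if "fst ` set U \<subseteq> ?H" for U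
      using that
    proof (induction U)
      case (Cons p U)
      obtain h b where p: "p = (h, b)" by (cases p)
      have "fst ` set h \<subseteq> X" using Cons.prems p w by auto
      moreover from this have "fst ` set (winv h) \<subseteq> X" by (auto simp: winv_def)
      ultimately show ?case using Cons p by (auto simp: image_Un)
    qed simp
    \<comment> \<open>A nonzero residue assignment that respects all relations among
      \<open>?H\<close>. If there were none, every element of \<open>A\<close> would be
      trivial.\<close>
    have "\<exists>a h. h \<in> ?H \<and> \<not> ?m dvd a h \<and> (\<forall>U. fst ` set U \<subseteq> ?H \<longrightarrow>
        word_eval G \<theta> (expand U) = \<one>\<^bsub>G\<^esub> \<longrightarrow> ?m dvd exponent_sum a U)"
    proof (rule ccontr)
      assume no: "\<not> ?thesis"
      have "word_eval G \<theta> h = \<one>\<^bsub>G\<^esub>" if "h \<in> ?H" for h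
      proof (rule word_eval_trivial_if_no_cyclic_quotient [OF is_group \<theta> r _ _ _ that])
        show "finite ?H" using A(2) by simp
        show "\<exists>gs. free_reduce (expand (conjugates r gs)) = free_reduce (expand U)"
          if "fst ` set U \<subseteq> ?H" "word_eval G \<theta> (expand U) = \<one>\<^bsub>G\<^esub>" for U
          using kernel HX that by blast
        show "\<exists>U. fst ` set U \<subseteq> ?H \<and> word_eval G \<theta> (expand U) = \<one>\<^bsub>G\<^esub> \<and> \<not> ?m dvd exponent_sum a U"
          if "h \<in> ?H" "\<not> ?m dvd a h" for a h
          using no that by blast
      qed
      then have "word_eval G \<theta> ` ?H \<subseteq> {\<one>\<^bsub>G\<^esub>}" by (intro image_subsetI) simp
      then have "A \<subseteq> {\<one>\<^bsub>G\<^esub>}" unfolding AH .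
      then have "generate G A \<subseteq> {\<one>\<^bsub>G\<^esub>}" by (rule generate_subgroup_incl) (rule triv_subgroup)
      then show False using A(3) generate.one [of G A] by auto
    qed
    then obtain a h where ah: "h \<in> ?H" "\<not> ?m dvd a h" "\<And>U. fst ` set U \<subseteq> ?H \<Longrightarrow>
        word_eval G \<theta> (expand U) = \<one>\<^bsub>G\<^esub> \<Longrightarrow> ?m dvd exponent_sum a U" by blast
    have "0 < ?m" using r(1) by (auto simp: cyclically_reduced_def)
    from finite_index_if_cyclic_quotient [where \<theta> = \<theta> and a = a, OF \<theta> this ah]
    show "\<exists>N D. subgroup N G \<and> N \<subset> generate G A \<and> finite D \<and> D \<subseteq> carrier G \<and> generate G A = N <#>\<^bsub>G\<^esub> D"
      unfolding AH by blast
  qed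
qed

end
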